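(* Let $\mathbb F$ be a field, let $\Lambda$ be a finite linearly ordered set of cardinality $n$, and let $M=M(\mathbb F,\Lambda)$ be the McLain group determined by $\Lambda$ and $\mathbb F$ (which is isomorphic to the group of all upper unitriangular $n\times n$ matrices over $\mathbb F$). Then $P(M)=Z_\rho(M)$, where $\rho=\lfloor n/2\rfloor$.
   Context: For a group $G$, the pseudocentre is $P(G)=\bigcap_{x\in G}C_G(x)^G$, where $C_G(x)$ is the centralizer of $x$ in $G$ and, for a subgroup $H\leq G$, $H^G$ is the normal closure of $H$ in $G$. $Z_k(G)$ is the $k$-th term of the upper central series of $G$ (with $Z_0(G)=\{1\}$, $Z_1(G)=Z(G)$). For a field $\mathbb F$ and a partially ordered set $\Lambda$, let $V$ be an $\mathbb F$-vector space with basis $\{v_\lambda:\lambda\in\Lambda\}$; for $\lambda<\mu$ let $e_{\lambda,\mu}$ be the linear map with $v_\lambda\mapsto v_\mu$ and $v_\zeta\mapsto 0$ for $\zeta\neq\lambda$ (maps are composed so that $e_{\lambda,\mu}e_{\mu,\zeta}=e_{\lambda,\zeta}$). The McLain group is $M(\mathbb F,\Lambda)=\langle 1+ae_{\lambda,\mu}:\lambda<\mu,\ a\in\mathbb F\rangle$, a group of invertible linear maps of $V$. *)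

theory Defs
  imports "HOL-Algebra.Generated_Groups" Complex_Main
begin

section \<open>Pseudocentre and upper central series\<close>

definition centralizer :: "('a, 'b) monoid_scheme \<Rightarrow> 'a \<Rightarrow> 'a set" where
  "centralizer G x = {y \<in> carrier G. y \<otimes>\<^bsub>G\<^esub> x = x \<otimes>\<^bsub>G\<^esub> y}"

definition normal_closure :: "('a, 'b) monoid_scheme \<Rightarrow> 'a set \<Rightarrow> 'a set" where
  "normal_closure G H = \<Inter> {N. N \<lhd> G \<and> H \<subseteq> N}"

definition pseudocentre :: "('a, 'b) monoid_scheme \<Rightarrow> 'a set" where
  "pseudocentre G = (\<Inter>x\<in>carrier G. normal_closure G (centralizer G x))"

definition group_centre :: "('a, 'b) monoid_scheme \<Rightarrow> 'a set" where
  "group_centre G = {z \<in> carrier G. \<forall>x\<in>carrier G. z \<otimes>\<^bsub>G\<^esub> x = x \<otimes>\<^bsub>G\<^esub> z}"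

primrec upper_central :: "('a, 'b) monoid_scheme \<Rightarrow> nat \<Rightarrow> 'a set" where
  "upper_central G 0 = {\<one>\<^bsub>G\<^esub>}"
| "upper_central G (Suc k) =
     {x \<in> carrier G. upper_central G k #>\<^bsub>G\<^esub> x \<in> group_centre (G Mod upper_central G k)}"

lemma (in group) upper_central_1: "upper_central G 1 = group_centre G"
proof -
  have coset: "{\<one>} #> x = {x}" if "x \<in> carrier G" for x
    using that by (simp add: r_coset_def)
  have mult: "{x} <#> {y} = {x \<otimes> y}" for x y
    by (simp add: set_mult_def)
  have carrier: "carrier (G Mod {\<one>}) = (\<lambda>x. {x}) ` carrier G"
    by (auto simp: FactGroup_def RCOSETS_def coset)
  have "upper_central G 1 = {x \<in> carrier G. {x} \<in> group_centre (G Mod {\<one>})}"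
    by (auto simp: coset)
  also have "\<dots> = group_centre G"
    unfolding group_centre_def carrier by (auto simp: FactGroup_def mult)
  finally show ?thesis .
qed


section \<open>McLain groups\<close>

text \<open>The vector space is the whole type \<open>'v\<close>; the poset \<open>\<Lambda>\<close> is a subset of the ordered
  type \<open>'l\<close>, and only the values of \<open>v\<close> on \<open>\<Lambda>\<close> matter.\<close>

locale poset_basis = vector_space scale
  for scale :: "'f::field \<Rightarrow> 'v::ab_group_add \<Rightarrow> 'v" (infixr \<open>*s\<close> 75) +
  fixes v :: "'l::order \<Rightarrow> 'v"
    and \<Lambda> :: "'l set"
  assumes inj_basis: "inj_on v \<Lambda>"
    and independent_basis: "independent (v ` \<Lambda>)"
    and span_basis: "span (v ` \<Lambda>) = UNIV"
begin

text \<open>Maps are composed from left to right, so that \<open>e\<^bsub>\<lambda>\<mu>\<^esub> e\<^bsub>\<mu>\<zeta>\<^esub> = e\<^bsub>\<lambda>\<zeta>\<^esub>\<close>.\<close>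

definition GL :: "('v \<Rightarrow> 'v) monoid" where
  "GL = \<lparr>carrier = {f. Vector_Spaces.linear scale scale f \<and> bij f},
         mult = (\<lambda>f g. g \<circ> f), one = id\<rparr>"

definition e :: "'l \<Rightarrow> 'l \<Rightarrow> 'v \<Rightarrow> 'v" where
  "e l m = vector_space_pair.construct scale scale (v ` \<Lambda>) (\<lambda>b. if b = v l then v m else 0)"

definition transvection :: "'f \<Rightarrow> 'l \<Rightarrow> 'l \<Rightarrow> 'v \<Rightarrow> 'v" where
  "transvection a l m = (\<lambda>x. x + a *s e l m x)"

definition mclain_group :: "('v \<Rightarrow> 'v) monoid" where
  "mclain_group = GL\<lparr>carrier :=
     generate GL {transvection a l m | a l m. l \<in> \<Lambda> \<and> m \<in> \<Lambda> \<and> l < m}\<rparr>"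

sublocale vs_pair: vector_space_pair scale scale ..

lemma linear_e: "Vector_Spaces.linear scale scale (e l m)"
  unfolding e_def by (rule vs_pair.linear_construct[OF independent_basis])

lemma e_basis:
  assumes "l \<in> \<Lambda>" "z \<in> \<Lambda>"
  shows "e l m (v z) = (if z = l then v m else 0)"
  unfolding e_def using assms inj_onD[OF inj_basis]
  by (auto simp: vs_pair.construct_basis[OF independent_basis])

lemma linear_eq_basis:
  assumes "Vector_Spaces.linear scale scale f" "Vector_Spaces.linear scale scale g"
    and "\<And>z. z \<in> \<Lambda> \<Longrightarrow> f (v z) = g (v z)"
  shows "f = g"
  using vs_pair.linear_eq_on[OF assms(1,2), of _ "v ` \<Lambda>"] assms(3) span_basis by blast

lemma e_comp:
  assumes "l \<in> \<Lambda>" "m \<in> \<Lambda>" "l' \<in> \<Lambda>"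
  shows "e l' k \<circ> e l m = (if l' = m then e l k else (\<lambda>_. 0))"
proof (rule linear_eq_basis)
  show "Vector_Spaces.linear scale scale (e l' k \<circ> e l m)"
    by (rule Vector_Spaces.linear_compose[OF linear_e linear_e])
  show "Vector_Spaces.linear scale scale (if l' = m then e l k else (\<lambda>_. 0))"
    using linear_e vs_pair.linear_zero by auto
  show "(e l' k \<circ> e l m) (v z) = (if l' = m then e l k else (\<lambda>_. 0)) (v z)" if "z \<in> \<Lambda>" for z
    using that assms vs_pair.linear_0[OF linear_e] by (auto simp: e_basis)
qed

lemma group_GL: "group GL"
proof (rule groupI)
  fix f assume f: "f \<in> carrier GL"
  have "f \<circ> inv_into UNIV f = id" "bij (inv_into UNIV f)"
    using f by (auto simp: GL_def surj_iff[symmetric] bij_is_surj bij_imp_bij_inv)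
  moreover have "Vector_Spaces.linear scale scale (inv_into UNIV f)"
    using f bij_module_hom_imp_inv_module_hom[of scale scale f]
    by (simp add: GL_def module_hom_eq_linear)
  ultimately show "\<exists>g\<in>carrier GL. g \<otimes>\<^bsub>GL\<^esub> f = \<one>\<^bsub>GL\<^esub>"
    by (auto simp: GL_def)
qed (auto simp: GL_def Vector_Spaces.linear_compose bij_comp linear_id o_assoc)

lemma transvection_in_GL:
  assumes "l \<in> \<Lambda>" "m \<in> \<Lambda>" "l < m"
  shows "transvection a l m \<in> carrier GL"
proof -
  have ee: "e l m (e l m x) = 0" for x
    using e_comp[of l m l m] assms by (auto simp: fun_eq_iff)
  interpret E: Vector_Spaces.linear scale scale "e l m" by (rule linear_e)
  have lin: "Vector_Spaces.linear scale scale (transvection a l m)"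
    unfolding transvection_def by unfold_locales
      (auto simp: E.add E.scale algebra_simps)
  moreover have "bij (transvection a l m)"
    by (rule o_bij[where g = "transvection (- a) l m"])
      (auto simp: transvection_def fun_eq_iff E.add E.scale E.diff ee)
  ultimately show ?thesis by (simp add: GL_def)
qed

lemma group_mclain_group: "group mclain_group"
  unfolding mclain_group_def
  by (rule subgroup.subgroup_is_group[OF group.generate_is_subgroup[OF group_GL] group_GL])
    (auto simp: transvection_in_GL)

end

end

theory Submission
  imports Defs "HOL-Library.Function_Algebras"
begin

text \<open>
  Identify the McLain group with the group of unitriangular matrices \<open>1 + X\<close>, with indices below
  \<open>n\<close>. Then \<open>Z\<^sub>k\<close> consists of the matrices with \<open>X i j = 0\<close> for \<open>j - i < n - k\<close>, so a position
  \<open>(i, j)\<close> is allowed in \<open>Z\<^sub>\<rho>\<close> iff \<open>2 (j - i) \<ge> n\<close>.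

  If \<open>2 (j - i) < n\<close>, some antidiagonal \<open>X\<close> has a centralizer that vanishes on the block
  \<open>{i..j} \<times> {i..j}\<close>; vanishing on a block defines a normal subgroup, so the position \<open>(i, j)\<close>
  vanishes on the pseudocentre.

  If \<open>2 (j - i) \<ge> n\<close>, let \<open>N\<close> be a normal subgroup containing the centralizer of \<open>1 + X\<close>. Unless
  \<open>X\<close> itself has an entry from which commutators produce elements of \<open>N\<close> with a prescribed entry at
  \<open>(i, j)\<close> and otherwise only entries above or to the right of it, the columns \<open>i..2i\<close> of \<open>X\<close> live
  in the \<open>i\<close> rows before \<open>i\<close>, hence are dependent, and likewise the rows \<open>2i+1..j\<close>. This gives a
  column vector \<open>u\<close> and a row vector \<open>w\<close> with \<open>X u = 0\<close>, \<open>w X = 0\<close>, so \<open>1 + u w\<close> centralizes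
  \<open>1 + X\<close>, and commutators of \<open>1 + u w\<close> do the job.
\<close>

section \<open>Pseudocentre and upper central series under isomorphisms\<close>

text \<open>Any normal subgroup \<open>M\<close> competing for the closure in \<open>H\<close> pulls
  back along the inverse of \<open>h\<close> to a normal subgroup of \<open>G\<close> that contains
  \<open>A\<close>.\<close>

lemma normal_closure_iso_subset:
  assumes "h \<in> iso G H" "group G" "group H" "A \<subseteq> carrier G"
  shows "h ` normal_closure G A \<subseteq> normal_closure H (h ` A)"
proof -
  interpret G: group G by fact
  have "h ` normal_closure G A \<subseteq> M" if M: "M \<lhd> H" "h ` A \<subseteq> M" for M
  proof -
    let ?g = "inv_into (carrier G) h"
    have bij: "bij_betw h (carrier G) (carrier H)"
      using assms(1) by (auto simp: iso_def)
    have "?g \<in> iso H G" using G.iso_set_sym[OF assms(1)] .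
    then have "?g ` M \<lhd> G" using M(1) assms(2,3) iso_normal_subgroup by blast
    moreover have "A \<subseteq> ?g ` M"
    proof
      fix a assume "a \<in> A"
      then have "a = ?g (h a)" "h a \<in> M" using assms(4) bij M(2)
        by (auto simp: bij_betw_def inv_into_f_f subset_iff)
      then show "a \<in> ?g ` M" by blast
    qed
    ultimately have "normal_closure G A \<subseteq> ?g ` M" by (auto simp: normal_closure_def)
    moreover have "M \<subseteq> carrier H" using M(1) normal_imp_subgroup subgroup.subset by blast
    then have "h ` ?g ` M \<subseteq> M" using bij
      by (auto simp: bij_betw_def f_inv_into_f subset_iff)
    ultimately show ?thesis by blast
  qed
  then show ?thesis by (auto simp: normal_closure_def)
qed

lemma normal_closure_subset:
  assumes "N \<lhd> G" "A \<subseteq> N"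
  shows "normal_closure G A \<subseteq> N"
  using assms by (auto simp: normal_closure_def)

lemma (in group) normal_closure_subset_carrier:
  "A \<subseteq> carrier G \<Longrightarrow> normal_closure G A \<subseteq> carrier G"
  by (rule normal_closure_subset[OF normal_self])

lemma centralizer_subset_carrier: "centralizer G x \<subseteq> carrier G"
  by (auto simp: centralizer_def)

lemma (in group) pseudocentre_subset_carrier: "pseudocentre G \<subseteq> carrier G"
  using normal_closure_subset_carrier[OF centralizer_subset_carrier] one_closed
  by (auto simp: pseudocentre_def)

lemma iso_centralizer:
  assumes "h \<in> iso G H" "x \<in> carrier G" "group G" "group H"
  shows "h ` centralizer G x = centralizer H (h x)"
proof -
  interpret group_hom G H h
    using assms by (simp add: group_hom_def group_hom_axioms_def iso_def)
  have bij: "inj_on h (carrier G)" "carrier H = h ` carrier G"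
    using assms(1) by (auto simp: iso_def bij_betw_def)
  have "h y \<in> centralizer H (h x) \<longleftrightarrow> y \<in> centralizer G x" if "y \<in> carrier G" for y
  proof -
    have "h y \<otimes>\<^bsub>H\<^esub> h x = h x \<otimes>\<^bsub>H\<^esub> h y \<longleftrightarrow> h (y \<otimes>\<^bsub>G\<^esub> x) = h (x \<otimes>\<^bsub>G\<^esub> y)"
      using that assms(2) by simp
    also have "\<dots> \<longleftrightarrow> y \<otimes>\<^bsub>G\<^esub> x = x \<otimes>\<^bsub>G\<^esub> y"
      using that assms(2) by (intro inj_on_eq_iff[OF bij(1)]) auto
    finally show ?thesis using that by (simp add: centralizer_def)
  qed
  moreover have "centralizer H (h x) \<subseteq> h ` carrier G" "centralizer G x \<subseteq> carrier G"
    unfolding bij(2)[symmetric] by (rule centralizer_subset_carrier)+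
  ultimately show ?thesis by blast
qed

lemma pseudocentre_iso_subset:
  assumes "h \<in> iso G H" "group G" "group H"
  shows "h ` pseudocentre G \<subseteq> pseudocentre H"
proof -
  have "h ` pseudocentre G \<subseteq> normal_closure H (centralizer H y)" if "y \<in> carrier H" for y
  proof -
    obtain x where x: "x \<in> carrier G" "y = h x"
      using assms(1) \<open>y \<in> carrier H\<close> by (auto simp: iso_def bij_betw_def)
    then have "h ` pseudocentre G \<subseteq> h ` normal_closure G (centralizer G x)"
      by (auto simp: pseudocentre_def)
    also have "\<dots> \<subseteq> normal_closure H (centralizer H y)"
      using normal_closure_iso_subset[OF assms centralizer_subset_carrier]
        iso_centralizer[OF assms(1) x(1) assms(2,3)] x(2) by metis
    finally show ?thesis .
  qed
  then show ?thesis by (auto simp: pseudocentre_def)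
qed

lemma pseudocentre_iso:
  assumes "h \<in> iso G H" "group G" "group H"
  shows "pseudocentre H = h ` pseudocentre G"
proof
  let ?g = "inv_into (carrier G) h"
  have "?g ` pseudocentre H \<subseteq> pseudocentre G"
    using pseudocentre_iso_subset group.iso_set_sym assms by metis
  then have "h ` ?g ` pseudocentre H \<subseteq> h ` pseudocentre G" by blast
  moreover have "h (?g y) = y" if "y \<in> pseudocentre H" for y
    using that group.pseudocentre_subset_carrier[OF assms(3)] assms(1)
    by (auto simp: iso_def bij_betw_def subset_iff intro!: f_inv_into_f)
  ultimately show "pseudocentre H \<subseteq> h ` pseudocentre G" by (force simp: image_iff)
qed (rule pseudocentre_iso_subset[OF assms])

text \<open>Cosets of \<open>a\<close> and \<open>b\<close> coincide exactly if
  \<open>a \<otimes> inv b\<close> lies in \<open>H\<close>. For the two products of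
  \<open>x\<close> and \<open>y\<close> this turns centrality in the quotient into a condition on
  commutators.\<close>

lemma (in normal) central_mod_iff:
  assumes "x \<in> carrier G"
  shows "H #> x \<in> group_centre (G Mod H) \<longleftrightarrow>
    (\<forall>y\<in>carrier G. (x \<otimes> y) \<otimes> inv (y \<otimes> x) \<in> H)"
proof -
  have "H #> a = H #> b \<longleftrightarrow> a \<otimes> inv b \<in> H" if "a \<in> carrier G" "b \<in> carrier G" for a b
    using that rcos_module[OF is_group, of b a] repr_independence[of a H b]
      rcos_self[of a H] is_subgroup by (metis is_group)
  then show ?thesis using assms
    by (auto simp: group_centre_def FactGroup_def RCOSETS_def rcos_sum)
qed

text \<open>The quotient in the recursion is known to be a group only once the previous term is
  normal, so normality is carried through the induction. The next term is the preimage of the centre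
  of that quotient.\<close>

lemma (in group) upper_central_normal: "upper_central G k \<lhd> G"
proof (induction k)
  case 0
  show ?case by (simp add: one_is_normal)
next
  case (Suc k)
  interpret N: normal "upper_central G k" G by fact
  let ?h = "\<lambda>x. upper_central G k #> x"
  let ?Q = "G Mod upper_central G k"
  interpret Q: group ?Q by (rule N.factorgroup_is_group)
  interpret h: group_hom G ?Q ?h
    by (simp add: group_hom_def group_hom_axioms_def Q.group_axioms group_axioms N.r_coset_hom_Mod)
  have mem: "x \<in> upper_central G (Suc k) \<longleftrightarrow>
      x \<in> carrier G \<and> (\<forall>q\<in>carrier ?Q. ?h x \<otimes>\<^bsub>?Q\<^esub> q = q \<otimes>\<^bsub>?Q\<^esub> ?h x)" for x
    using h.hom_closed by (auto simp: group_centre_def)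
  show ?case
  proof (rule normal_invI)
    show "subgroup (upper_central G (Suc k)) G"
    proof (rule subgroupI)
      show "upper_central G (Suc k) \<subseteq> carrier G" using mem by blast
      have "\<one> \<in> upper_central G (Suc k)"
        unfolding mem using h.hom_one Q.l_one Q.r_one one_closed by metis
      then show "upper_central G (Suc k) \<noteq> {}" by blast
    next
      fix a assume a: "a \<in> upper_central G (Suc k)"
      then have "?h a \<in> carrier ?Q" using mem h.hom_closed by blast
      then have "inv\<^bsub>?Q\<^esub> (?h a) \<otimes>\<^bsub>?Q\<^esub> q = q \<otimes>\<^bsub>?Q\<^esub> inv\<^bsub>?Q\<^esub> (?h a)" if "q \<in> carrier ?Q" for q
        using a that unfolding mem
        by (metis Q.inv_solve_left Q.inv_solve_right Q.m_closed Q.inv_closed)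
      then show "inv a \<in> upper_central G (Suc k)"
        using a unfolding mem by (metis h.hom_inv inv_closed)
    next
      fix a b assume ab: "a \<in> upper_central G (Suc k)" "b \<in> upper_central G (Suc k)"
      then have "?h a \<in> carrier ?Q" "?h b \<in> carrier ?Q" using mem h.hom_closed by blast+
      then have "?h a \<otimes>\<^bsub>?Q\<^esub> ?h b \<otimes>\<^bsub>?Q\<^esub> q = q \<otimes>\<^bsub>?Q\<^esub> (?h a \<otimes>\<^bsub>?Q\<^esub> ?h b)" if "q \<in> carrier ?Q" for q
        using ab that unfolding mem by (metis Q.m_assoc)
      then show "a \<otimes> b \<in> upper_central G (Suc k)"
        using ab unfolding mem by (metis h.hom_mult m_closed)
    qed
  next
    fix x z assume xz: "x \<in> carrier G" "z \<in> upper_central G (Suc k)"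
    then have z: "z \<in> carrier G" and hz: "?h x \<otimes>\<^bsub>?Q\<^esub> ?h z = ?h z \<otimes>\<^bsub>?Q\<^esub> ?h x"
      unfolding mem using h.hom_closed by metis+
    have "?h (x \<otimes> z \<otimes> inv x) = ?h (z \<otimes> x \<otimes> inv x)"
      using xz(1) z hz by (simp only: h.hom_mult m_closed inv_closed)
    also have "\<dots> = ?h z" using xz(1) z by (simp add: m_assoc)
    finally have "?h (x \<otimes> z \<otimes> inv x) = ?h z" .
    then show "x \<otimes> z \<otimes> inv x \<in> upper_central G (Suc k)"
      using xz unfolding mem by (metis m_closed inv_closed)
  qed
qed

text \<open>A description without quotients, which transfers along isomorphisms and can be computed
  with matrices.\<close>

lemma (in group) upper_central_Suc_iff:
  "x \<in> upper_central G (Suc k) \<longleftrightarrow>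
    x \<in> carrier G \<and> (\<forall>y\<in>carrier G. (x \<otimes> y) \<otimes> inv (y \<otimes> x) \<in> upper_central G k)"
  using normal.central_mod_iff[OF upper_central_normal] by auto

lemma (in group) upper_central_subset_carrier: "upper_central G k \<subseteq> carrier G"
  using upper_central_normal normal_imp_subgroup subgroup.subset by blast

lemma upper_central_iso:
  assumes "h \<in> iso G H" "group G" "group H"
  shows "upper_central H k = h ` upper_central G k"
proof -
  interpret group_hom G H h
    using assms by (simp add: group_hom_def group_hom_axioms_def iso_def)
  have bij: "bij_betw h (carrier G) (carrier H)"
    using assms(1) by (simp add: iso_def)
  \<comment> \<open>Stated elementwise and for arbitrary \<open>x\<close>, so that the induction
    hypothesis applies to commutators.\<close>
  have "h x \<in> upper_central H k \<longleftrightarrow> x \<in> upper_central G k" if "x \<in> carrier G" for x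
    using that
  proof (induction k arbitrary: x)
    case 0
    then show ?case using bij inj_on_eq_iff[of h "carrier G" x "\<one>\<^bsub>G\<^esub>"]
      by (simp add: bij_betw_def)
  next
    case (Suc k)
    have carrier: "carrier H = h ` carrier G" using bij by (simp add: bij_betw_def)
    have "h x \<otimes>\<^bsub>H\<^esub> h y \<otimes>\<^bsub>H\<^esub> inv\<^bsub>H\<^esub> (h y \<otimes>\<^bsub>H\<^esub> h x) = h ((x \<otimes>\<^bsub>G\<^esub> y) \<otimes>\<^bsub>G\<^esub> inv\<^bsub>G\<^esub> (y \<otimes>\<^bsub>G\<^esub> x))"
      if "y \<in> carrier G" for y
      using that Suc.prems by simp
    then show ?case using Suc
      by (simp add: G.upper_central_Suc_iff H.upper_central_Suc_iff carrier
        del: upper_central.simps hom_mult hom_inv)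
  qed
  moreover have "upper_central H k \<subseteq> h ` carrier G"
    using H.upper_central_subset_carrier bij by (simp add: bij_betw_def)
  ultimately show ?thesis using G.upper_central_subset_carrier by blast
qed

section \<open>Unitriangular matrices\<close>

definition mat_mult :: "nat \<Rightarrow> (nat \<Rightarrow> nat \<Rightarrow> 'a::field) \<Rightarrow> (nat \<Rightarrow> nat \<Rightarrow> 'a) \<Rightarrow> nat \<Rightarrow> nat \<Rightarrow> 'a" where
  "mat_mult n A B = (\<lambda>i j. \<Sum>k<n. A i k * B k j)"

text \<open>Matrices are total functions that vanish outside the index range, so equality of
  matrices is equality of functions.\<close>

definition strict_upper :: "nat \<Rightarrow> (nat \<Rightarrow> nat \<Rightarrow> 'a::field) set" where
  "strict_upper n = {X. \<forall>i j. X i j \<noteq> 0 \<longrightarrow> i < j \<and> j < n}"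

text \<open>A strictly upper triangular matrix \<open>X\<close> stands for the unitriangular matrix \<open>1 + X\<close>.\<close>

definition unitriangular :: "nat \<Rightarrow> (nat \<Rightarrow> nat \<Rightarrow> 'a::field) monoid" where
  "unitriangular n = \<lparr>carrier = strict_upper n, mult = (\<lambda>X Y. X + Y + mat_mult n X Y), one = 0\<rparr>"

lemma unitriangular_simps [simp]:
  "carrier (unitriangular n) = strict_upper n"
  "X \<otimes>\<^bsub>unitriangular n\<^esub> Y = X + Y + mat_mult n X Y"
  "\<one>\<^bsub>unitriangular n\<^esub> = 0"
  by (simp_all add: unitriangular_def)

lemma mat_mult_assoc: "mat_mult n (mat_mult n A B) C = mat_mult n A (mat_mult n B C)"
proof (intro ext)
  fix i j
  have "mat_mult n (mat_mult n A B) C i j = (\<Sum>k<n. \<Sum>l<n. A i l * B l k * C k j)"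
    by (simp add: mat_mult_def sum_distrib_right)
  also have "\<dots> = (\<Sum>l<n. \<Sum>k<n. A i l * B l k * C k j)" by (rule sum.swap)
  also have "\<dots> = mat_mult n A (mat_mult n B C) i j"
    by (simp add: mat_mult_def sum_distrib_left mult.assoc)
  finally show "mat_mult n (mat_mult n A B) C i j = mat_mult n A (mat_mult n B C) i j" .
qed

lemma mat_mult_distrib:
  "mat_mult n (A + B) C = mat_mult n A C + mat_mult n B C"
  "mat_mult n A (B + C) = mat_mult n A B + mat_mult n A C"
  "mat_mult n (A - B) C = mat_mult n A C - mat_mult n B C"
  "mat_mult n A (B - C) = mat_mult n A B - mat_mult n A C"
  "mat_mult n (- A) C = - mat_mult n A C"
  "mat_mult n A (- C) = - mat_mult n A C"
  "mat_mult n 0 C = 0" "mat_mult n A 0 = 0"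
  by (intro ext, simp add: mat_mult_def distrib_left distrib_right left_diff_distrib
      right_diff_distrib sum.distrib sum_subtractf sum_negf)+

lemma strict_upperD: "X \<in> strict_upper n \<Longrightarrow> \<not> (i < j \<and> j < n) \<Longrightarrow> X i j = 0"
  by (auto simp: strict_upper_def)

lemma strict_upperD': "X \<in> strict_upper n \<Longrightarrow> X i j \<noteq> 0 \<Longrightarrow> i < j \<and> j < n"
  by (auto simp: strict_upper_def)

lemma strict_upperI: "(\<And>i j. X i j \<noteq> 0 \<Longrightarrow> i < j \<and> j < n) \<Longrightarrow> X \<in> strict_upper n"
  by (simp add: strict_upper_def)

lemma mat_mult_nonzeroE:
  assumes "mat_mult n A B i j \<noteq> 0"
  obtains k where "k < n" "A i k \<noteq> 0" "B k j \<noteq> 0"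
proof -
  have "\<exists>k\<in>{..<n}. A i k * B k j \<noteq> 0"
    using assms unfolding mat_mult_def by (meson sum.neutral)
  then show ?thesis using that by auto
qed

lemma strict_upper_add:
  assumes "X \<in> strict_upper n" "Y \<in> strict_upper n"
  shows "X + Y \<in> strict_upper n"
proof (rule strict_upperI)
  fix i j assume "(X + Y) i j \<noteq> 0"
  then have "X i j \<noteq> 0 \<or> Y i j \<noteq> 0" by auto
  then show "i < j \<and> j < n" using assms strict_upperD' by blast
qed

lemma strict_upper_uminus: "X \<in> strict_upper n \<Longrightarrow> - X \<in> strict_upper n"
  by (simp add: strict_upper_def)

lemma strict_upper_mult:
  assumes "X \<in> strict_upper n" "Y \<in> strict_upper n"
  shows "mat_mult n X Y \<in> strict_upper n"
proof (rule strict_upperI)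
  fix i j assume "mat_mult n X Y i j \<noteq> 0"
  then obtain k where "X i k \<noteq> 0" "Y k j \<noteq> 0" by (rule mat_mult_nonzeroE)
  then show "i < j \<and> j < n"
    using strict_upperD'[OF assms(1), of i k] strict_upperD'[OF assms(2), of k j] by simp
qed

lemma strict_upper_zero: "0 \<in> strict_upper n"
  by (simp add: strict_upper_def)

text \<open>The recursion \<open>Q\<^sub>k\<^sub>+\<^sub>1 = - X - Q\<^sub>k X\<close> approximates \<open>(1 + X)\<^sup>-\<^sup>1 - 1\<close>: the error
  \<open>Q\<^sub>k + X + Q\<^sub>k X\<close> is multiplied by \<open>- X\<close> in each step.\<close>

lemma unitriangular_left_inverse:
  assumes "X \<in> strict_upper n"
  shows "\<exists>Y\<in>strict_upper n. Y + X + mat_mult n Y X = 0"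
proof -
  have "\<exists>Y\<in>strict_upper n. \<forall>i j. (Y + X + mat_mult n Y X) i j \<noteq> 0 \<longrightarrow> i + k < j \<and> j < n" for k
  proof (induction k)
    case 0
    have "0 + X + mat_mult n 0 X = X" by (simp only: mat_mult_distrib add_0 add_0_right)
    then have "\<forall>i j. (0 + X + mat_mult n 0 X) i j \<noteq> 0 \<longrightarrow> i + 0 < j \<and> j < n"
      using assms unfolding strict_upper_def by (simp only: mem_Collect_eq add_0_right)
    then show ?case by (rule bexI[OF _ strict_upper_zero])
  next
    case (Suc k)
    then obtain Y where Y: "Y \<in> strict_upper n"
      "\<And>i j. (Y + X + mat_mult n Y X) i j \<noteq> 0 \<Longrightarrow> i + k < j \<and> j < n" by blast
    let ?R = "Y + X + mat_mult n Y X"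
    let ?Z = "- X - mat_mult n Y X"
    have "?Z = - X + - mat_mult n Y X" by simp
    then have "?Z \<in> strict_upper n"
      using assms Y(1) by (metis strict_upper_add strict_upper_uminus strict_upper_mult)
    moreover have "?Z + X + mat_mult n ?Z X = - mat_mult n ?R X"
      by (simp add: mat_mult_distrib)
    moreover have "i + Suc k < j \<and> j < n" if "(- mat_mult n ?R X) i j \<noteq> 0" for i j
    proof -
      from that have "mat_mult n ?R X i j \<noteq> 0" by simp
      then obtain l where "?R i l \<noteq> 0" "X l j \<noteq> 0" by (rule mat_mult_nonzeroE)
      then show ?thesis using Y(2)[of i l] strict_upperD'[OF assms, of l j] by linarith
    qed
    ultimately show ?case by metis
  qed
  \<comment> \<open>After \<open>n\<close> steps an error entry would need \<open>i + n < j\<close>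
    and \<open>j < n\<close>, so no error is left.\<close>
  from this[of n] obtain Y where Y: "Y \<in> strict_upper n"
      "\<And>i j. (Y + X + mat_mult n Y X) i j \<noteq> 0 \<Longrightarrow> i + n < j \<and> j < n" by blast
  have "(Y + X + mat_mult n Y X) i j = 0" for i j
    using Y(2)[of i j] by linarith
  then have "Y + X + mat_mult n Y X = 0" by (intro ext) (simp only: zero_fun_apply)
  then show ?thesis using Y(1) by blast
qed

lemma group_unitriangular: "group (unitriangular n)"
proof (rule groupI)
  fix X :: "nat \<Rightarrow> nat \<Rightarrow> 'a" assume "X \<in> carrier (unitriangular n)"
  then show "\<exists>Y\<in>carrier (unitriangular n).
      Y \<otimes>\<^bsub>unitriangular n\<^esub> X = \<one>\<^bsub>unitriangular n\<^esub>"
    using unitriangular_left_inverse[of X n] by simp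
next
  fix X Y Z :: "nat \<Rightarrow> nat \<Rightarrow> 'a"
  show "X \<otimes>\<^bsub>unitriangular n\<^esub> Y \<otimes>\<^bsub>unitriangular n\<^esub> Z =
      X \<otimes>\<^bsub>unitriangular n\<^esub> (Y \<otimes>\<^bsub>unitriangular n\<^esub> Z)"
    by (simp only: unitriangular_simps mat_mult_distrib mat_mult_assoc add_ac)
qed (simp_all add: mat_mult_distrib strict_upper_zero strict_upper_add strict_upper_mult)

definition mat_unit :: "nat \<Rightarrow> nat \<Rightarrow> 'a \<Rightarrow> nat \<Rightarrow> nat \<Rightarrow> 'a::field" where
  "mat_unit a b t = (\<lambda>r s. if r = a \<and> s = b then t else 0)"

lemma mat_unit_strict_upper: "a < b \<Longrightarrow> b < n \<Longrightarrow> mat_unit a b t \<in> strict_upper n"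
  by (simp add: strict_upper_def mat_unit_def)

lemma mat_mult_unit_left:
  "b < n \<Longrightarrow> mat_mult n (mat_unit a b t) X r s = (if r = a then t * X b s else 0)"
  by (simp add: mat_mult_def mat_unit_def if_distrib[of "\<lambda>x. x * _"] cong: if_cong)

lemma mat_mult_unit_right:
  "a < n \<Longrightarrow> mat_mult n X (mat_unit a b t) r s = (if s = b then X r a * t else 0)"
  by (simp add: mat_mult_def mat_unit_def if_distrib[of "\<lambda>x. _ * x"] cong: if_cong)

text \<open>Comparing \<open>(1 + H)(1 + Y)(1 + X) = (1 + X)(1 + Y)\<close> gives \<open>H (1 + Y)(1 + X) = XY - YX\<close>.\<close>

lemma unitriangular_commutator:
  assumes "X \<in> strict_upper n" "Y \<in> strict_upper n"
  defines "H \<equiv> (X \<otimes>\<^bsub>unitriangular n\<^esub> Y) \<otimes>\<^bsub>unitriangular n\<^esub>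
    inv\<^bsub>unitriangular n\<^esub> (Y \<otimes>\<^bsub>unitriangular n\<^esub> X)"
  defines "B \<equiv> mat_mult n X Y - mat_mult n Y X"
  shows "\<exists>P\<in>strict_upper n. H = B + mat_mult n B P"
    and "B = H + mat_mult n H (Y + X + mat_mult n Y X)"
proof -
  interpret group "unitriangular n :: (nat \<Rightarrow> nat \<Rightarrow> 'a) monoid" by (rule group_unitriangular)
  let ?U = "unitriangular n :: (nat \<Rightarrow> nat \<Rightarrow> 'a) monoid"
  let ?yx = "Y \<otimes>\<^bsub>?U\<^esub> X" and ?xy = "X \<otimes>\<^bsub>?U\<^esub> Y"
  have in_U: "X \<in> carrier ?U" "Y \<in> carrier ?U" using assms by simp_all
  have yx: "?yx \<in> carrier ?U" and xy: "?xy \<in> carrier ?U" using in_U by (rule_tac [!] m_closed)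
  have P: "inv\<^bsub>?U\<^esub> ?yx \<in> strict_upper n" using inv_closed[OF yx] by simp
  have "H \<otimes>\<^bsub>?U\<^esub> ?yx = ?xy"
    unfolding H_def using xy yx by (simp only: m_assoc inv_closed l_inv r_one)
  then show B: "B = H + mat_mult n H (Y + X + mat_mult n Y X)"
    by (simp add: B_def algebra_simps)
  have "?yx + inv\<^bsub>?U\<^esub> ?yx + mat_mult n ?yx (inv\<^bsub>?U\<^esub> ?yx) = 0"
    using r_inv[OF yx] by simp
  then have "mat_mult n H (?yx + inv\<^bsub>?U\<^esub> ?yx + mat_mult n ?yx (inv\<^bsub>?U\<^esub> ?yx)) = 0"
    by (simp only: mat_mult_distrib)
  then have "H = B + mat_mult n B (inv\<^bsub>?U\<^esub> ?yx)"
    unfolding B by (simp add: mat_mult_distrib mat_mult_assoc algebra_simps)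
  then show "\<exists>P\<in>strict_upper n. H = B + mat_mult n B P" using P by blast
qed

lemma mat_mult_right_nonzeroE:
  assumes "mat_mult n A P r s \<noteq> 0" "P \<in> strict_upper n"
  obtains k where "k < s" "A r k \<noteq> 0"
  using assms by (metis mat_mult_nonzeroE strict_upperD')

section \<open>Strips above the diagonal and the upper central series\<close>

definition strip :: "nat \<Rightarrow> nat \<Rightarrow> (nat \<Rightarrow> nat \<Rightarrow> 'a::field) set" where
  "strip n m = {X \<in> strict_upper n. \<forall>i j. X i j \<noteq> 0 \<longrightarrow> i + m \<le> j}"

lemma strip_subset: "strip n m \<subseteq> strict_upper n"
  by (auto simp: strip_def)

lemma stripD: "X \<in> strip n m \<Longrightarrow> X i j \<noteq> 0 \<Longrightarrow> i + m \<le> j"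
  by (auto simp: strip_def)

lemma add_nonzeroE:
  fixes A B :: "nat \<Rightarrow> nat \<Rightarrow> 'a::field"
  assumes "(A + B) i j \<noteq> 0"
  obtains "A i j \<noteq> 0" | "B i j \<noteq> 0"
  using assms by (metis add.right_neutral plus_fun_apply)

text \<open>Elimination: positions are ordered so that everything weakly above and to the right of a
  position comes before it. A left factor \<open>1 + W\<close> from \<open>S\<close> clears the last
  nonzero entry and disturbs only earlier positions, so repeated clearing ends at the
  identity.\<close>

lemma subgroup_contains_strip:
  assumes S: "subgroup S (unitriangular n)"
    and corner: "\<And>i j \<alpha>. i < j \<Longrightarrow> j < n \<Longrightarrow> i + m \<le> j \<Longrightarrow>
      \<exists>W\<in>S. W i j = \<alpha> \<and> (\<forall>r c. W r c \<noteq> 0 \<longrightarrow> r \<le> i \<and> j \<le> c)"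
  shows "strip n m \<subseteq> S"
proof
  interpret group "unitriangular n :: (nat \<Rightarrow> nat \<Rightarrow> 'a) monoid" by (rule group_unitriangular)
  \<comment> \<open>Row by row numbering, with each row read from right to left.\<close>
  let ?pos = "\<lambda>r c. r * n + (n - 1 - c)"
  have clear: "Z \<in> S" if "Z \<in> strict_upper n" "\<And>r c. Z r c \<noteq> 0 \<Longrightarrow> r + m \<le> c \<and> ?pos r c < d" for d Z
    using that
  proof (induction d arbitrary: Z)
    case 0
    then have "Z = 0" by (intro ext) (auto simp: zero_fun_def)
    then show ?case using subgroup.one_closed[OF S] unitriangular_simps(3) by metis
  next
    case (Suc d)
    \<comment> \<open>Decoding \<open>d\<close> gives the only position with that number, the one to
      be cleared next.\<close>
    define i j where "i = d div n" and "j = n - 1 - d mod n"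
    have pos_eq: "r = i \<and> c = j" if "c < n" "?pos r c = d" for r c
    proof -
      have "n - 1 - c < n" using that(1) by simp
      then have "d div n = r" "d mod n = n - 1 - c" using that(2) by auto
      then show ?thesis using that(1) by (simp add: i_def j_def)
    qed
    show ?case
    proof (cases "Z i j = 0")
      case True
      have "r + m \<le> c \<and> ?pos r c < d" if "Z r c \<noteq> 0" for r c
      proof -
        have "c < n" using that Suc.prems(1) strict_upperD' by blast
        then have "?pos r c \<noteq> d" using that True pos_eq by metis
        then show ?thesis using Suc.prems(2)[OF that] by linarith
      qed
      then show ?thesis using Suc.IH Suc.prems(1) by blast
    next
      case False
      then have ij: "i < j" "j < n" "i + m \<le> j"
        using strict_upperD'[OF Suc.prems(1)] Suc.prems(2) by blast+
      have "n - 1 - j = d mod n"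
        using ij(2) mod_less_divisor[of n d] unfolding j_def by linarith
      then have d: "?pos i j = d" unfolding i_def by (metis div_mult_mod_eq)
      obtain W where W: "W \<in> S" "W i j = - Z i j" "\<And>r c. W r c \<noteq> 0 \<Longrightarrow> r \<le> i \<and> j \<le> c"
        using corner[OF ij] by metis
      have W_up: "W \<in> strict_upper n" using subgroup.subset[OF S] W(1) by auto
      define Z' where "Z' = W + Z + mat_mult n W Z"
      have Z'_up: "Z' \<in> strict_upper n"
        unfolding Z'_def using W_up Suc.prems(1) by (intro strict_upper_add strict_upper_mult)
      \<comment> \<open>Row \<open>i\<close> of \<open>W\<close> starts at column \<open>j\<close>,
        and multiplication by \<open>Z\<close> moves it further right. So the product does not reach
        \<open>(i, j)\<close>, and the entries of \<open>W\<close> and \<open>Z\<close> cancel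
        there.\<close>
      have "mat_mult n W Z i j = 0"
        using W(3) Suc.prems(1) mat_mult_right_nonzeroE[of n W Z i j] by (metis leD)
      then have Z'_ij: "Z' i j = 0" using W(2) by (simp add: Z'_def)
      have "r + m \<le> c \<and> ?pos r c < d" if nz: "Z' r c \<noteq> 0" for r c
      proof -
        have c: "c < n" using strict_upperD'[OF Z'_up nz] by blast
        have "?pos r c \<noteq> d" using nz Z'_ij pos_eq[OF c] by metis
        moreover have "r + m \<le> c \<and> ?pos r c \<le> d"
        proof -
          consider "Z r c \<noteq> 0" | "r \<le> i" "j \<le> c"
          proof -
            have "Z r c \<noteq> 0 \<or> (r \<le> i \<and> j \<le> c)"
            proof (rule ccontr)
              assume neg: "\<not> ?thesis"
              then have "W r c = 0" using W(3) by blast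
              then have "mat_mult n W Z r c \<noteq> 0" using nz neg by (simp add: Z'_def)
              then obtain k where "k < c" "W r k \<noteq> 0"
                using mat_mult_right_nonzeroE Suc.prems(1) by blast
              then show False using W(3)[of r k] neg by auto
            qed
            then show thesis using that by blast
          qed
          then show ?thesis
          proof cases
            case 1
            then show ?thesis using Suc.prems(2) by fastforce
          next
            case 2
            then have "r * n \<le> i * n" "n - 1 - c \<le> n - 1 - j" by auto
            then show ?thesis using 2 ij(3) d by linarith
          qed
        qed
        ultimately show ?thesis by linarith
      qed
      then have "Z' \<in> S" using Suc.IH Z'_up by blast
      moreover have "Z' = W \<otimes>\<^bsub>unitriangular n\<^esub> Z" by (simp add: Z'_def)
      ultimately have "W \<otimes>\<^bsub>unitriangular n\<^esub> Z \<in> S" by metis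
      then have "inv\<^bsub>unitriangular n\<^esub> W \<otimes>\<^bsub>unitriangular n\<^esub> (W \<otimes>\<^bsub>unitriangular n\<^esub> Z) \<in> S"
        by (rule subgroup.m_closed[OF S subgroup.m_inv_closed[OF S W(1)]])
      moreover have "inv\<^bsub>unitriangular n\<^esub> W \<otimes>\<^bsub>unitriangular n\<^esub> (W \<otimes>\<^bsub>unitriangular n\<^esub> Z) = Z"
        using W_up Suc.prems(1) inv_solve_left[of Z W "W \<otimes>\<^bsub>unitriangular n\<^esub> Z"]
          m_closed[of W Z] unitriangular_simps(1) by metis
      ultimately show ?thesis by metis
    qed
  qed
  fix X :: "nat \<Rightarrow> nat \<Rightarrow> 'a" assume X: "X \<in> strip n m"
  show "X \<in> S"
  proof (rule clear)
    show up: "X \<in> strict_upper n" using X strip_subset by blast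
    fix r c assume "X r c \<noteq> 0"
    then have rc: "r < c" "c < n" "r + m \<le> c" using strict_upperD'[OF up] stripD[OF X] by blast+
    then have "Suc r * n \<le> n * n" by (intro mult_right_mono) auto
    then have "r * n + (n - 1 - c) < n * n" using rc by simp
    then show "r + m \<le> c \<and> r * n + (n - 1 - c) < n * n" using rc by blast
  qed
qed

lemma strip_mult:
  assumes "X \<in> strip n m" "P \<in> strict_upper n"
  shows "mat_mult n X P \<in> strip n m"
proof -
  have "i + m \<le> j" if "mat_mult n X P i j \<noteq> 0" for i j
    using that mat_mult_right_nonzeroE[OF that assms(2)] stripD[OF assms(1)]
    by (metis le_trans less_imp_le)
  then show ?thesis
    using assms strip_subset strict_upper_mult by (auto simp: strip_def)
qed

lemma strip_add: "X \<in> strip n m \<Longrightarrow> Y \<in> strip n m \<Longrightarrow> X + Y \<in> strip n m"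
  unfolding strip_def using strict_upper_add[of X n Y]
  by (auto elim!: add_nonzeroE simp del: plus_fun_apply)

text \<open>The group commutator and \<open>XY - YX\<close> differ by an invertible unitriangular
  right factor, and strips are stable under such factors.\<close>

lemma commutator_in_strip_iff:
  assumes "X \<in> strict_upper n" "Y \<in> strict_upper n"
  shows "(X \<otimes>\<^bsub>unitriangular n\<^esub> Y) \<otimes>\<^bsub>unitriangular n\<^esub>
      inv\<^bsub>unitriangular n\<^esub> (Y \<otimes>\<^bsub>unitriangular n\<^esub> X) \<in> strip n m \<longleftrightarrow>
    mat_mult n X Y - mat_mult n Y X \<in> strip n m" (is "?H \<in> _ \<longleftrightarrow> ?B \<in> _")
proof -
  have "Y + X + mat_mult n Y X \<in> strict_upper n"
    using assms by (intro strict_upper_add strict_upper_mult)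
  moreover have "?B = ?H + mat_mult n ?H (Y + X + mat_mult n Y X)"
    using unitriangular_commutator(2)[OF assms] .
  moreover obtain P where "P \<in> strict_upper n" "?H = ?B + mat_mult n ?B P"
    using unitriangular_commutator(1)[OF assms] by blast
  ultimately show ?thesis using strip_add strip_mult by metis
qed

text \<open>Multiplication by a strictly upper triangular \<open>Y\<close> moves entries at least
  one diagonal outwards, which gives one inclusion. Conversely, a commutator with a neighbouring
  matrix unit moves an entry outwards by only one diagonal, so an entry too close to the diagonal
  stays too close.\<close>

lemma upper_central_unitriangular:
  "k \<le> n \<Longrightarrow> upper_central (unitriangular n) k = (strip n (n - k) :: (nat \<Rightarrow> nat \<Rightarrow> 'a::field) set)"
proof (induction k)
  case 0
  have "X = 0" if X: "X \<in> strip n n" for X :: "nat \<Rightarrow> nat \<Rightarrow> 'a"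
  proof (intro ext, rule ccontr)
    fix i j assume "X i j \<noteq> 0 i j"
    then have "X i j \<noteq> 0" by simp
    then show False using X stripD[OF X] strip_subset strict_upperD' by fastforce
  qed
  moreover have "0 \<in> strip n n" by (simp add: strip_def strict_upper_zero)
  ultimately show ?case by auto
next
  case (Suc k)
  interpret group "unitriangular n :: (nat \<Rightarrow> nat \<Rightarrow> 'a) monoid" by (rule group_unitriangular)
  have "X \<in> strip n (n - Suc k) \<longleftrightarrow>
      (\<forall>Y\<in>strict_upper n. mat_mult n X Y - mat_mult n Y X \<in> strip n (n - k))"
    if X: "X \<in> strict_upper n" for X :: "nat \<Rightarrow> nat \<Rightarrow> 'a"
  proof
    assume strip: "X \<in> strip n (n - Suc k)"
    show "\<forall>Y\<in>strict_upper n. mat_mult n X Y - mat_mult n Y X \<in> strip n (n - k)"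
    proof
      fix Y :: "nat \<Rightarrow> nat \<Rightarrow> 'a" assume Y: "Y \<in> strict_upper n"
      have "i + (n - k) \<le> j" if nz: "(mat_mult n X Y - mat_mult n Y X) i j \<noteq> 0" for i j
      proof -
        from nz have "mat_mult n X Y i j \<noteq> 0 \<or> mat_mult n Y X i j \<noteq> 0" by auto
        then obtain l where "X i l \<noteq> 0 \<and> Y l j \<noteq> 0 \<or> Y i l \<noteq> 0 \<and> X l j \<noteq> 0"
          by (metis mat_mult_nonzeroE)
        then show ?thesis
          using stripD[OF strip, of i l] strict_upperD'[OF Y, of l j]
            stripD[OF strip, of l j] strict_upperD'[OF Y, of i l] Suc.prems by fastforce
      qed
      moreover have "mat_mult n X Y - mat_mult n Y X \<in> strict_upper n"
        using X Y strict_upper_add strict_upper_uminus strict_upper_mult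
        by (metis diff_conv_add_uminus)
      ultimately show "mat_mult n X Y - mat_mult n Y X \<in> strip n (n - k)"
        by (simp add: strip_def)
    qed
  next
    assume comm: "\<forall>Y\<in>strict_upper n. mat_mult n X Y - mat_mult n Y X \<in> strip n (n - k)"
    have "r + (n - Suc k) \<le> c" if nz: "X r c \<noteq> 0" for r c
    proof (rule ccontr)
      assume far: "\<not> ?thesis"
      have rc: "r < c" "c < n" using strict_upperD'[OF X nz] by auto
      \<comment> \<open>An entry at \<open>(0, n - 1)\<close> would not be too close to the
        diagonal, so there is room to move up or to the right.\<close>
      have "0 < r \<or> Suc c < n" using far rc by auto
      then show False
      proof
        assume r: "0 < r"
        let ?Y = "mat_unit (r - 1) r 1 :: nat \<Rightarrow> nat \<Rightarrow> 'a"
        have "(mat_mult n X ?Y - mat_mult n ?Y X) (r - 1) c = - X r c"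
          using r rc by (simp add: mat_mult_unit_left mat_mult_unit_right)
        moreover have "?Y \<in> strict_upper n" using r rc by (intro mat_unit_strict_upper) auto
        ultimately have "r - 1 + (n - k) \<le> c" using comm nz
          by (metis neg_equal_0_iff_equal stripD)
        then show False using far r Suc.prems by linarith
      next
        assume c: "Suc c < n"
        let ?Y = "mat_unit c (Suc c) 1 :: nat \<Rightarrow> nat \<Rightarrow> 'a"
        have "(mat_mult n X ?Y - mat_mult n ?Y X) r (Suc c) = X r c"
          using c rc by (simp add: mat_mult_unit_left mat_mult_unit_right)
        moreover have "?Y \<in> strict_upper n" using c by (intro mat_unit_strict_upper) auto
        ultimately have "r + (n - k) \<le> Suc c" using comm nz by (metis stripD)
        then show False using far Suc.prems by linarith
      qed
    qed
    then show "X \<in> strip n (n - Suc k)" using X by (simp add: strip_def)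
  qed
  moreover have "upper_central (unitriangular n) k = (strip n (n - k) :: (nat \<Rightarrow> nat \<Rightarrow> 'a) set)"
    using Suc by simp
  ultimately have "X \<in> upper_central (unitriangular n) (Suc k) \<longleftrightarrow> X \<in> strip n (n - Suc k)"
    for X :: "nat \<Rightarrow> nat \<Rightarrow> 'a"
    unfolding upper_central_Suc_iff unitriangular_simps(1)
    using subsetD[OF strip_subset, of X n] commutator_in_strip_iff[of X n]
    by (metis (no_types, lifting))
  then show ?case by blast
qed

text \<open>Restriction to the block is a homomorphism, because an entry of a product of strictly
  upper triangular matrices uses only intermediate indices between its row and its column, which
  stay inside the block. The set is the kernel.\<close>

lemma block_kernel_normal:
  "{X \<in> strict_upper n. \<forall>r c. a \<le> r \<and> c \<le> b \<longrightarrow> X r c = 0} \<lhd> unitriangular n"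
proof -
  let ?U = "unitriangular n :: (nat \<Rightarrow> nat \<Rightarrow> 'a) monoid"
  let ?h = "\<lambda>X :: nat \<Rightarrow> nat \<Rightarrow> 'a. \<lambda>r c. if a \<le> r \<and> c \<le> b then X r c else 0"
  have "mat_mult n (?h X) (?h Y) = ?h (mat_mult n X Y)"
    if "X \<in> strict_upper n" "Y \<in> strict_upper n" for X Y :: "nat \<Rightarrow> nat \<Rightarrow> 'a"
  proof (intro ext)
    fix r c
    show "mat_mult n (?h X) (?h Y) r c = ?h (mat_mult n X Y) r c"
    proof (cases "a \<le> r \<and> c \<le> b")
      case True
      have "?h X r k * ?h Y k c = X r k * Y k c" for k
        using True strict_upperD[OF that(1), of r k] strict_upperD[OF that(2), of k c] by auto
      then show ?thesis using True by (simp add: mat_mult_def)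
    qed (auto simp: mat_mult_def)
  qed
  then have "?h (X \<otimes>\<^bsub>?U\<^esub> Y) = ?h X \<otimes>\<^bsub>?U\<^esub> ?h Y"
    if "X \<in> strict_upper n" "Y \<in> strict_upper n" for X Y :: "nat \<Rightarrow> nat \<Rightarrow> 'a"
    using that by (simp add: fun_eq_iff)
  moreover have "?h X \<in> strict_upper n" if "X \<in> strict_upper n" for X
    using that by (simp add: strict_upper_def)
  ultimately interpret group_hom ?U ?U ?h
    unfolding group_hom_def group_hom_axioms_def
    by (intro conjI group_unitriangular homI) (simp_all only: unitriangular_simps(1))
  have "kernel ?U ?U ?h = {X \<in> strict_upper n. \<forall>r c. a \<le> r \<and> c \<le> b \<longrightarrow> X r c = 0}"
    by (auto simp: kernel_def fun_eq_iff)
  then show ?thesis using normal_kernel by simp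
qed

section \<open>Normal subgroups containing a centralizer\<close>

lemma commutator_in_normal:
  assumes N: "N \<lhd> unitriangular n" and X: "X \<in> N" and Y: "Y \<in> strict_upper n"
  obtains P where "P \<in> strict_upper n"
    "mat_mult n X Y - mat_mult n Y X + mat_mult n (mat_mult n X Y - mat_mult n Y X) P \<in> N"
proof -
  interpret N: normal N "unitriangular n :: (nat \<Rightarrow> nat \<Rightarrow> 'a) monoid" by (rule N)
  let ?U = "unitriangular n :: (nat \<Rightarrow> nat \<Rightarrow> 'a) monoid"
  have Yc: "Y \<in> carrier ?U" using Y by simp
  have Xc: "X \<in> carrier ?U" using X by (rule N.mem_carrier)
  \<comment> \<open>The commutator is \<open>X\<close> times a conjugate of its inverse, and both
    factors lie in \<open>N\<close>.\<close>
  have "X \<otimes>\<^bsub>?U\<^esub> (Y \<otimes>\<^bsub>?U\<^esub> inv\<^bsub>?U\<^esub> X \<otimes>\<^bsub>?U\<^esub> inv\<^bsub>?U\<^esub> Y) \<in> N"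
    by (rule subgroup.m_closed[OF normal_imp_subgroup[OF N] X N.inv_op_closed2[OF Yc N.m_inv_closed[OF X]]])
  then have "(X \<otimes>\<^bsub>?U\<^esub> Y) \<otimes>\<^bsub>?U\<^esub> inv\<^bsub>?U\<^esub> (Y \<otimes>\<^bsub>?U\<^esub> X) \<in> N"
    using Xc Yc by (simp only: N.inv_mult_group N.m_assoc N.inv_closed N.m_closed)
  moreover have "X \<in> strict_upper n" using Xc by simp
  ultimately show thesis using unitriangular_commutator(1)[of X n Y] Y that by metis
qed

section \<open>Producing corners by commutators\<close>

definition cornered :: "nat \<Rightarrow> nat \<Rightarrow> (nat \<Rightarrow> nat \<Rightarrow> 'a::field) set" where
  "cornered i j = {W. \<forall>r c. W r c \<noteq> 0 \<longrightarrow> r \<le> i \<and> j \<le> c}"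

text \<open>Multiplying by an invertible upper triangular matrix on the right, as in a commutator,
  preserves corners and their leading entries.\<close>

lemma cornered_right_mult:
  assumes "B \<in> cornered i j" "P \<in> strict_upper n"
  shows "B + mat_mult n B P \<in> cornered i j" "(B + mat_mult n B P) i j = B i j"
proof -
  have B: "r \<le> i \<and> j \<le> c" if "B r c \<noteq> 0" for r c
    using assms(1) that by (simp add: cornered_def)
  have BP: "r \<le> i \<and> j < c" if nz: "mat_mult n B P r c \<noteq> 0" for r c
  proof -
    obtain k where "k < c" "B r k \<noteq> 0" using nz assms(2) by (rule mat_mult_right_nonzeroE)
    then show ?thesis using B by (meson le_less_trans)
  qed
  have "r \<le> i \<and> j \<le> c" if "(B + mat_mult n B P) r c \<noteq> 0" for r c
    using that B[of r c] BP[of r c] by (elim add_nonzeroE) auto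
  then show "B + mat_mult n B P \<in> cornered i j" by (simp add: cornered_def)
  show "(B + mat_mult n B P) i j = B i j" using BP[of i j] by auto
qed

text \<open>The commutator with a matrix unit at \<open>(l, j)\<close> copies column
  \<open>l\<close> of \<open>X\<close>, scaled by \<open>t\<close>, into column \<open>j\<close>.
  The other half of the commutator is removed by the vanishing of row \<open>j\<close>.\<close>

lemma push_corner:
  assumes N: "N \<lhd> unitriangular n" and X: "X \<in> N"
    and l: "l < j" "j < n" and row: "\<And>s. X j s = 0" and col: "\<And>r. X r l \<noteq> 0 \<Longrightarrow> r \<le> i"
  shows "\<exists>W\<in>N. W \<in> cornered i j \<and> W i j = X i l * t"
proof -
  let ?Y = "mat_unit l j t" and ?B = "mat_mult n X (mat_unit l j t) - mat_mult n (mat_unit l j t) X"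
  have Y: "?Y \<in> strict_upper n" using l by (rule mat_unit_strict_upper)
  obtain P where P: "P \<in> strict_upper n" "?B + mat_mult n ?B P \<in> N"
    using commutator_in_normal[OF N X Y] .
  have B: "?B r s = (if s = j then X r l * t else 0)" for r s
    using l row by (simp add: mat_mult_unit_left mat_mult_unit_right)
  have "?B \<in> cornered i j" unfolding cornered_def mem_Collect_eq B using col by auto
  then have "?B + mat_mult n ?B P \<in> cornered i j" "(?B + mat_mult n ?B P) i j = X i l * t"
    using cornered_right_mult[of ?B i j P n] P(1) B[of i j] by (simp_all del: plus_fun_apply)
  then show ?thesis using P(2) by blast
qed

text \<open>The commutator with a matrix unit at \<open>(i, k)\<close> copies row \<open>k\<close>
  up to row \<open>i\<close>. Column \<open>i\<close> of \<open>X\<close> lies to the left of the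
  corner, hence vanishes and contributes nothing. The sign in \<open>- t\<close> compensates that of
  the subtracted product.\<close>

lemma pull_corner:
  assumes N: "N \<lhd> unitriangular n" and X: "X \<in> N" "X \<in> cornered k j"
    and ik: "i < k" "k < j" "j < n"
  shows "\<exists>W\<in>N. W \<in> cornered i j \<and> W i j = t * X k j"
proof -
  let ?Y = "mat_unit i k (- t)"
  let ?B = "mat_mult n X (mat_unit i k (- t)) - mat_mult n (mat_unit i k (- t)) X"
  have Y: "?Y \<in> strict_upper n" using ik by (intro mat_unit_strict_upper) auto
  obtain P where P: "P \<in> strict_upper n" "?B + mat_mult n ?B P \<in> N"
    using commutator_in_normal[OF N X(1) Y] .
  have "X r i = 0" for r using X(2) ik unfolding cornered_def by fastforce
  then have B: "?B r s = (if r = i then t * X k s else 0)" for r s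
    using ik by (simp add: mat_mult_unit_left mat_mult_unit_right)
  have "?B \<in> cornered i j"
    unfolding cornered_def mem_Collect_eq B using X(2) by (auto simp: cornered_def)
  then have "?B + mat_mult n ?B P \<in> cornered i j" "(?B + mat_mult n ?B P) i j = t * X k j"
    using cornered_right_mult[of ?B i j P n] P(1) B[of i j] by (simp_all del: plus_fun_apply)
  then show ?thesis using P(2) by blast
qed

text \<open>The condition that \<open>subgroup_contains_strip\<close> demands at a single
  position.\<close>

definition full_corner :: "(nat \<Rightarrow> nat \<Rightarrow> 'a::field) set \<Rightarrow> nat \<Rightarrow> nat \<Rightarrow> bool" where
  "full_corner N i j \<longleftrightarrow> (\<forall>\<alpha>. \<exists>W\<in>N. W \<in> cornered i j \<and> W i j = \<alpha>)"

lemma full_corner_up: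
  assumes "N \<lhd> unitriangular n" "full_corner N k j" "i \<le> k" "k < j" "j < n"
  shows "full_corner N i j"
proof (cases "i = k")
  case False
  obtain W where "W \<in> N" "W \<in> cornered k j" "W k j = 1"
    using assms(2) unfolding full_corner_def by blast
  then show ?thesis
    using pull_corner[OF assms(1), of W k j i] assms False unfolding full_corner_def by fastforce
qed (use assms in simp)

text \<open>One nonzero entry suffices: the free scalar of \<open>push_corner\<close> can be divided
  by it, which realises every value.\<close>

lemma full_corner_push:
  assumes "N \<lhd> unitriangular n" "X \<in> N" "l < j" "j < n"
    and "\<And>s. X j s = 0" "\<And>r. X r l \<noteq> 0 \<Longrightarrow> r \<le> i" and nz: "X i l \<noteq> 0"
  shows "full_corner N i j"
  unfolding full_corner_def
proof
  fix \<alpha>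
  have "X i l * (\<alpha> / X i l) = \<alpha>" using nz by simp
  then show "\<exists>W\<in>N. W \<in> cornered i j \<and> W i j = \<alpha>"
    using push_corner[OF assms(1-6), of "\<alpha> / X i l"] by metis
qed

text \<open>The lowest nonzero entry of column \<open>c\<close>, in row \<open>k\<close>, is pushed
  to column \<open>j\<close>, and the resulting corner is pulled up to row \<open>i\<close>. Pushing
  needs a zero row \<open>j\<close>. This is automatic for \<open>j = n - 1\<close>; otherwise
  \<open>X\<close> is first replaced by its commutator with a matrix unit at
  \<open>(c, c + 1)\<close>, whose row \<open>j\<close> is zero.\<close>

lemma full_corner_left_entry:
  assumes N: "N \<lhd> unitriangular n" and X: "X \<in> N"
    and rc: "X r c \<noteq> 0" "i \<le> r" "c + n \<le> 2 * j" and j: "j < n"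
  shows "full_corner N i j"
proof -
  have X_up: "X \<in> strict_upper n"
    using N X normal_imp_subgroup subgroup.mem_carrier unitriangular_simps(1) by metis
  define k where "k = (GREATEST k. X k c \<noteq> 0)"
  have bound: "X r c \<noteq> 0 \<Longrightarrow> r \<le> c" for r using strict_upperD'[OF X_up] by fastforce
  have k: "X k c \<noteq> 0" unfolding k_def using rc(1) bound by (rule GreatestI_nat)
  have k_max: "r \<le> k" if "X r c \<noteq> 0" for r
    unfolding k_def using that bound by (rule Greatest_le_nat)
  have kc: "k < c" "c < j" using strict_upperD'[OF X_up k] rc j by auto
  have row: "X j s = 0" if "n \<le> Suc j" for s
    using that strict_upperD[OF X_up, of j s] by fastforce
  have "full_corner N k j"
  proof (cases "Suc j < n")
    case False
    then show ?thesis using full_corner_push[OF N X, of c j k] row k k_max kc j by auto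
  next
    case True
    \<comment> \<open>The bound \<open>c + n \<le> 2 * j\<close> leaves a column strictly between
      \<open>c\<close> and \<open>j\<close> once \<open>j\<close> is not the last index.\<close>
    then have c: "Suc c < j" using rc(3) by linarith
    let ?Y = "mat_unit c (Suc c) 1"
    let ?B = "mat_mult n X (mat_unit c (Suc c) 1) - mat_mult n (mat_unit c (Suc c) 1) X"
    have Y: "?Y \<in> strict_upper n" using c j by (intro mat_unit_strict_upper) auto
    obtain P where P: "P \<in> strict_upper n" "?B + mat_mult n ?B P \<in> N"
      using commutator_in_normal[OF N X Y] .
    define W where "W = ?B + mat_mult n ?B P"
    have B: "?B r s = (if s = Suc c then X r c else 0) - (if r = c then X (Suc c) s else 0)" for r s
      using c j by (simp add: mat_mult_unit_left mat_mult_unit_right)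
    have "?B j s = 0" for s
      unfolding B using c strict_upperD[OF X_up, of j c] by auto
    then have row_W: "\<And>s. W j s = 0" by (simp add: W_def mat_mult_def)
    \<comment> \<open>The commutator vanishes to the left of column \<open>c + 1\<close>, so the
      right factor leaves that column unchanged, and it is a copy of column \<open>c\<close> of
      \<open>X\<close>.\<close>
    have col_W: "W r (Suc c) = X r c" for r
    proof -
      have "?B r m = 0" if "m < Suc c" for m
        unfolding B using that strict_upperD[OF X_up, of "Suc c" m] by auto
      then have "mat_mult n ?B P r (Suc c) = 0" using mat_mult_right_nonzeroE P(1) by metis
      moreover have "?B r (Suc c) = X r c"
        unfolding B using strict_upperD[OF X_up, of "Suc c" "Suc c"] by auto
      ultimately show ?thesis by (simp add: W_def)
    qed
    have "W \<in> N" using P(2) by (simp add: W_def)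
    then show ?thesis using full_corner_push[of N n W "Suc c" j k] N c j row_W k k_max col_W by metis
  qed
  then show ?thesis using full_corner_up[OF N] k_max[OF rc(1)] rc(2) kc j by (meson le_trans less_trans)
qed

section \<open>Reflection in the antidiagonal\<close>

definition mirror :: "nat \<Rightarrow> (nat \<Rightarrow> nat \<Rightarrow> 'a::field) \<Rightarrow> nat \<Rightarrow> nat \<Rightarrow> 'a" where
  "mirror n X = (\<lambda>i j. if i < n \<and> j < n then X (n - 1 - j) (n - 1 - i) else 0)"

lemma mirror_mirror: "X \<in> strict_upper n \<Longrightarrow> mirror n (mirror n X) = X"
  using strict_upperD[of X n] by (auto simp: mirror_def fun_eq_iff)

lemma mirror_strict_upper: "X \<in> strict_upper n \<Longrightarrow> mirror n X \<in> strict_upper n"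
  by (rule strict_upperI) (force simp: mirror_def dest!: strict_upperD' split: if_splits)

lemma mirror_mat_mult: "mirror n (mat_mult n X Y) = mat_mult n (mirror n Y) (mirror n X)"
proof (intro ext)
  fix i j
  show "mirror n (mat_mult n X Y) i j = mat_mult n (mirror n Y) (mirror n X) i j"
  proof (cases "i < n \<and> j < n")
    case True
    have "(\<Sum>k<n. X (n - 1 - j) k * Y k (n - 1 - i)) =
        (\<Sum>k<n. X (n - 1 - j) (n - 1 - k) * Y (n - 1 - k) (n - 1 - i))"
      by (subst sum.nat_diff_reindex[symmetric]) simp
    then show ?thesis using True by (simp add: mirror_def mat_mult_def mult.commute)
  qed (auto simp: mirror_def mat_mult_def)
qed

text \<open>Reflection reverses products, so its composition with inversion is an automorphism.
  Since inversion maps \<open>N\<close> onto itself, this automorphism and the reflection have the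
  same image of \<open>N\<close>.\<close>

lemma mirror_normal:
  assumes "N \<lhd> unitriangular n"
  shows "mirror n ` N \<lhd> unitriangular n"
proof -
  let ?U = "unitriangular n :: (nat \<Rightarrow> nat \<Rightarrow> 'a) monoid"
  let ?h = "\<lambda>X. mirror n (inv\<^bsub>?U\<^esub> X)"
  interpret N: normal N ?U by (rule assms)
  have anti: "mirror n (X \<otimes>\<^bsub>?U\<^esub> Y) = mirror n Y \<otimes>\<^bsub>?U\<^esub> mirror n X" for X Y
    by (simp add: mirror_mat_mult[symmetric]) (simp add: mirror_def fun_eq_iff)
  have closed: "mirror n X \<in> carrier ?U" if "X \<in> carrier ?U" for X
    using that mirror_strict_upper by simp
  interpret group_hom ?U ?U ?h
    unfolding group_hom_def group_hom_axioms_def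
  proof (intro conjI group_unitriangular homI)
    fix X Y assume XY: "X \<in> carrier ?U" "Y \<in> carrier ?U"
    show "mirror n (inv\<^bsub>?U\<^esub> X) \<in> carrier ?U" by (intro closed N.inv_closed XY)
    show "mirror n (inv\<^bsub>?U\<^esub> (X \<otimes>\<^bsub>?U\<^esub> Y)) = mirror n (inv\<^bsub>?U\<^esub> X) \<otimes>\<^bsub>?U\<^esub> mirror n (inv\<^bsub>?U\<^esub> Y)"
      using XY by (simp only: N.inv_mult_group anti)
  qed
  have inv_N: "(\<lambda>X. inv\<^bsub>?U\<^esub> X) ` N = N"
  proof
    show "N \<subseteq> (\<lambda>X. inv\<^bsub>?U\<^esub> X) ` N"
    proof
      fix X assume "X \<in> N"
      then have "X = inv\<^bsub>?U\<^esub> (inv\<^bsub>?U\<^esub> X)" "inv\<^bsub>?U\<^esub> X \<in> N"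
        using N.m_inv_closed N.mem_carrier N.inv_inv by metis+
      then show "X \<in> (\<lambda>X. inv\<^bsub>?U\<^esub> X) ` N" by (rule image_eqI)
    qed
  qed auto
  have "?h ` carrier ?U = carrier ?U"
  proof
    show "carrier ?U \<subseteq> ?h ` carrier ?U"
    proof
      fix X assume X: "X \<in> carrier ?U"
      then have "X = ?h (inv\<^bsub>?U\<^esub> (mirror n X))"
        using closed N.inv_inv mirror_mirror unitriangular_simps(1) by metis
      then show "X \<in> ?h ` carrier ?U" using X closed by blast
    qed
  qed (use closed N.inv_closed in blast)
  then have "?h ` N \<lhd> ?U"
    using N.surj_hom_normal_subgroup[OF group_hom_axioms] by blast
  moreover have "?h ` N = mirror n ` N" using inv_N by (metis image_image)
  ultimately show ?thesis by metis
qed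

text \<open>The reflection of \<open>full_corner_left_entry\<close>: rows and columns trade places,
  and \<open>2 * i < r\<close> becomes the column bound required there.\<close>

lemma full_corner_lower_entry:
  assumes N: "N \<lhd> unitriangular n" and X: "X \<in> N"
    and rc: "X r c \<noteq> 0" "2 * i < r" "c \<le> j" and ij: "i < j" "j < n"
  shows "full_corner N i j"
  unfolding full_corner_def
proof
  fix \<alpha>
  have N_up: "X \<in> strict_upper n" if "X \<in> N" for X
    using N that normal_imp_subgroup subgroup.mem_carrier unitriangular_simps(1) by metis
  have rc': "r < c" "c < n" using strict_upperD'[OF N_up[OF X] rc(1)] by auto
  have "mirror n X (n - 1 - c) (n - 1 - r) \<noteq> 0" using rc rc' by (simp add: mirror_def)
  then have "full_corner (mirror n ` N) (n - 1 - j) (n - 1 - i)"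
    using rc rc' ij X by (intro full_corner_left_entry[OF mirror_normal[OF N], of "mirror n X"]) auto
  then obtain W where W: "W \<in> N" "mirror n W \<in> cornered (n - 1 - j) (n - 1 - i)"
    "mirror n W (n - 1 - j) (n - 1 - i) = \<alpha>"
    unfolding full_corner_def by blast
  have "W i j = \<alpha>" using W(3) ij by (simp add: mirror_def)
  moreover have "r \<le> i \<and> j \<le> c" if "W r c \<noteq> 0" for r c
  proof -
    have rc: "r < c" "c < n" using strict_upperD'[OF N_up[OF W(1)] that] by auto
    then have "mirror n W (n - 1 - c) (n - 1 - r) \<noteq> 0" using that by (simp add: mirror_def)
    then have "n - 1 - c \<le> n - 1 - j" "n - 1 - i \<le> n - 1 - r"
      using W(2) unfolding cornered_def by blast+
    then show ?thesis using rc ij by linarith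
  qed
  ultimately show "\<exists>W\<in>N. W \<in> cornered i j \<and> W i j = \<alpha>"
    using W(1) unfolding cornered_def by blast
qed

section \<open>Dependent rows and columns, and the lower bound for the pseudocentre\<close>

lemma homogeneous_system_nontrivial:
  fixes A :: "'i \<Rightarrow> 'j \<Rightarrow> 'a::field"
  assumes "finite I" "finite J" "card I < card J"
  shows "\<exists>u. (\<exists>c\<in>J. u c \<noteq> 0) \<and> (\<forall>c. c \<notin> J \<longrightarrow> u c = 0) \<and> (\<forall>k\<in>I. (\<Sum>c\<in>J. A k c * u c) = 0)"
  using assms
proof (induction I arbitrary: J A)
  case empty
  then obtain c where "c \<in> J" by fastforce
  then show ?case by (intro exI[of _ "\<lambda>x. if x = c then 1 else 0"]) auto
next
  case (insert k I)
  show ?case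
  proof (cases "\<forall>c\<in>J. A k c = 0")
    case True
    have "card I < card J" using insert by simp
    then obtain u where "\<exists>c\<in>J. u c \<noteq> 0" "\<forall>c. c \<notin> J \<longrightarrow> u c = 0" "\<forall>k\<in>I. (\<Sum>c\<in>J. A k c * u c) = 0"
      using insert.IH[OF insert.prems(1)] by blast
    then show ?thesis using True by (intro exI[of _ u]) simp
  next
    case False
    then obtain c0 where c0: "c0 \<in> J" "A k c0 \<noteq> 0" by blast
    \<comment> \<open>The unknown \<open>c0\<close> is eliminated from the other equations with the
      pivot \<open>A k c0\<close>.\<close>
    define J' where "J' = J - {c0}"
    have "finite J'" "card I < card J'" using insert c0(1) by (simp_all add: J'_def)
    then obtain u where u: "\<exists>c\<in>J'. u c \<noteq> 0" "\<forall>c. c \<notin> J' \<longrightarrow> u c = 0"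
      "\<forall>l\<in>I. (\<Sum>c\<in>J'. (A l c - A l c0 / A k c0 * A k c) * u c) = 0"
      using insert.IH[of J' "\<lambda>l c. A l c - A l c0 / A k c0 * A k c"] by blast
    define s where "s = (\<Sum>c\<in>J'. A k c * u c)"
    \<comment> \<open>The value at \<open>c0\<close> comes from solving equation \<open>k\<close>
      for the eliminated unknown.\<close>
    let ?u = "u(c0 := - s / A k c0)"
    have sum_J: "(\<Sum>c\<in>J. A l c * ?u c) = A l c0 * (- s / A k c0) + (\<Sum>c\<in>J'. A l c * u c)" for l
    proof -
      have "(\<Sum>c\<in>J. A l c * ?u c) = A l c0 * ?u c0 + (\<Sum>c\<in>J'. A l c * ?u c)"
        unfolding J'_def by (rule sum.remove[OF insert.prems(1) c0(1)])
      also have "(\<Sum>c\<in>J'. A l c * ?u c) = (\<Sum>c\<in>J'. A l c * u c)"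
        by (rule sum.cong) (auto simp: J'_def)
      finally show ?thesis by simp
    qed
    have "(\<Sum>c\<in>J. A l c * ?u c) = 0" if "l \<in> insert k I" for l
    proof (cases "l = k")
      case True
      then show ?thesis unfolding sum_J using c0(2) by (simp add: s_def)
    next
      case False
      then have "0 = (\<Sum>c\<in>J'. (A l c - A l c0 / A k c0 * A k c) * u c)" using u(3) that by simp
      also have "\<dots> = (\<Sum>c\<in>J'. A l c * u c) - A l c0 / A k c0 * s"
        by (simp add: s_def left_diff_distrib sum_subtractf sum_distrib_left mult.assoc)
      finally show ?thesis unfolding sum_J by simp
    qed
    moreover have "\<exists>c\<in>J. ?u c \<noteq> 0" using u(1) by (auto simp: J'_def)
    moreover have "\<forall>c. c \<notin> J \<longrightarrow> ?u c = 0" using u(2) c0(1) by (auto simp: J'_def)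
    ultimately show ?thesis by blast
  qed
qed

lemma full_corner_normal_closure:
  assumes X: "X \<in> strict_upper n" and N: "N \<lhd> unitriangular n"
    and cent: "centralizer (unitriangular n) X \<subseteq> N"
    and ij: "i < j" "j < n" "n + 2 * i \<le> 2 * j"
  shows "full_corner N i j"
proof -
  have XN: "X \<in> N" using X cent by (auto simp: centralizer_def)
  show ?thesis
  proof (cases "\<exists>r c. X r c \<noteq> 0 \<and> (i \<le> r \<and> c + n \<le> 2 * j \<or> 2 * i < r \<and> c \<le> j)")
    case True
    then show ?thesis
      using full_corner_left_entry[OF N XN] full_corner_lower_entry[OF N XN] ij(1,2) by blast
  next
    case False
    \<comment> \<open>From row \<open>i\<close> on, the columns \<open>i..2i\<close> of
      \<open>X\<close> vanish, so only \<open>i\<close> equations constrain the \<open>i + 1\<close>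
      unknowns.\<close>
    have "card {..<i} < card {i..2 * i}" by simp
    then obtain u where u: "\<exists>c\<in>{i..2 * i}. u c \<noteq> 0" "\<forall>c. c \<notin> {i..2 * i} \<longrightarrow> u c = 0"
      "\<forall>k\<in>{..<i}. (\<Sum>c\<in>{i..2 * i}. X k c * u c) = 0"
      using homogeneous_system_nontrivial[of "{..<i}" "{i..2 * i}" X] by blast
    \<comment> \<open>The rows \<open>2i+1..j\<close> of \<open>X\<close> vanish up to column
      \<open>j\<close>. This leaves \<open>n - 1 - j\<close> equations for \<open>j - 2i\<close>
      unknowns, fewer because \<open>n + 2i \<le> 2j\<close>.\<close>
    have "card {j<..<n} < card {2 * i<..j}" using ij by simp
    then obtain w where w: "\<exists>c\<in>{2 * i<..j}. w c \<noteq> 0" "\<forall>c. c \<notin> {2 * i<..j} \<longrightarrow> w c = 0"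
      "\<forall>k\<in>{j<..<n}. (\<Sum>c\<in>{2 * i<..j}. X c k * w c) = 0"
      using homogeneous_system_nontrivial[of "{j<..<n}" "{2 * i<..j}" "\<lambda>k c. X c k"] by blast
    have Xu: "(\<Sum>k<n. X r k * u k) = 0" for r
    proof (cases "r < i")
      case True
      have "(\<Sum>k<n. X r k * u k) = (\<Sum>k\<in>{i..2 * i}. X r k * u k)"
        using u(2) ij by (intro sum.mono_neutral_right) auto
      then show ?thesis using u(3) True by simp
    next
      case False
      then have "X r k * u k = 0" for k
        using u(2) ij \<open>\<not> (\<exists>r c. _ r c)\<close> by (cases "k \<in> {i..2 * i}") fastforce+
      then show ?thesis by (intro sum.neutral ballI)
    qed
    have wX: "(\<Sum>k<n. w k * X k c) = 0" for c
    proof (cases "j < c \<and> c < n")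
      case True
      have "(\<Sum>k<n. w k * X k c) = (\<Sum>k\<in>{2 * i<..j}. w k * X k c)"
        using w(2) ij by (intro sum.mono_neutral_right) auto
      then show ?thesis using w(3) True by (simp add: mult.commute)
    next
      case c: False
      have "w k * X k c = 0" for k
      proof (cases "k \<in> {2 * i<..j}")
        case True
        then show ?thesis using False c strict_upperD[OF X, of k c] by fastforce
      qed (use w(2) in simp)
      then show ?thesis by (intro sum.neutral ballI)
    qed
    \<comment> \<open>Matrices of rank at most one, with rows at most \<open>2i\<close> and columns
      beyond \<open>2i\<close>, hence strictly upper triangular. The scalar \<open>a\<close>
      supplies arbitrary values.\<close>
    define Y where "Y a = (\<lambda>r c. a * u r * w c)" for a
    have Y_nz: "r \<in> {i..2 * i} \<and> c \<in> {2 * i<..j}" if "Y a r c \<noteq> 0" for a r c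
      using that u(2) w(2) by (auto simp: Y_def)
    have Y_up: "Y a \<in> strict_upper n" for a
      by (rule strict_upperI) (use Y_nz ij in fastforce)
    have XY: "mat_mult n X (Y a) = 0" for a
    proof (intro ext)
      fix r c
      have "mat_mult n X (Y a) r c = (\<Sum>k<n. X r k * u k) * (a * w c)"
        unfolding mat_mult_def sum_distrib_right Y_def by (intro sum.cong) (auto simp: ac_simps)
      then show "mat_mult n X (Y a) r c = 0 r c" using Xu by simp
    qed
    have YX: "mat_mult n (Y a) X = 0" for a
    proof (intro ext)
      fix r c
      have "mat_mult n (Y a) X r c = (a * u r) * (\<Sum>k<n. w k * X k c)"
        unfolding mat_mult_def sum_distrib_left Y_def by (intro sum.cong) (auto simp: ac_simps)
      then show "mat_mult n (Y a) X r c = 0 r c" using wX by simp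
    qed
    have YN: "Y a \<in> N" for a
      using cent Y_up XY YX by (auto simp: centralizer_def add.commute)
    \<comment> \<open>The last nonzero entry of \<open>u\<close> and the first nonzero entry of
      \<open>w\<close> locate the corner of \<open>Y a\<close>.\<close>
    define k where "k = Max {r \<in> {i..2 * i}. u r \<noteq> 0}"
    have k: "k \<in> {r \<in> {i..2 * i}. u r \<noteq> 0}" unfolding k_def using u(1) by (intro Max_in) auto
    have k_max: "r \<le> k" if "u r \<noteq> 0" for r
      unfolding k_def using that u(2) by (intro Max_ge) auto
    define l where "l = Min {c \<in> {2 * i<..j}. w c \<noteq> 0}"
    have l: "l \<in> {c \<in> {2 * i<..j}. w c \<noteq> 0}" unfolding l_def using w(1) by (intro Min_in) auto
    have l_min: "l \<le> c" if "w c \<noteq> 0" for c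
      unfolding l_def using that w(2) by (intro Min_le) auto
    have "full_corner N k j"
    proof (cases "l = j")
      case True
      have "Y a \<in> cornered k j" for a
        using k_max l_min True by (auto simp: cornered_def Y_def)
      moreover have "Y (\<alpha> / (u k * w j)) k j = \<alpha>" for \<alpha>
        using k l True by (simp add: Y_def)
      ultimately show ?thesis unfolding full_corner_def using YN by blast
    next
      case False
      \<comment> \<open>Since \<open>j > 2i\<close>, row \<open>j\<close> lies below the support of
        \<open>u\<close>, as pushing requires.\<close>
      have "Y 1 j s = 0" for s using u(2) ij by (simp add: Y_def)
      moreover have "r \<le> k" if "Y 1 r l \<noteq> 0" for r using that k_max by (simp add: Y_def)
      moreover have "Y 1 k l \<noteq> 0" using k l by (simp add: Y_def)
      ultimately show ?thesis
        using full_corner_push[OF N YN, of l j 1 k] l False ij by fastforce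
    qed
    then show ?thesis using full_corner_up[OF N, of k j i] k ij by auto
  qed
qed

lemma strip_subset_normal_closure:
  assumes "X \<in> strict_upper n"
  shows "strip n (n - n div 2) \<subseteq> normal_closure (unitriangular n) (centralizer (unitriangular n) X)"
proof -
  have "strip n (n - n div 2) \<subseteq> N"
    if N: "N \<lhd> unitriangular n" "centralizer (unitriangular n) X \<subseteq> N" for N
  proof (rule subgroup_contains_strip[OF normal_imp_subgroup[OF N(1)]])
    fix i j \<alpha> assume ij: "i < j" "j < n" "i + (n - n div 2) \<le> j"
    \<comment> \<open>The width \<open>n - n div 2\<close> is half of \<open>n\<close> rounded up,
      so the strip condition is exactly this inequality.\<close>
    then have "n + 2 * i \<le> 2 * j" by linarith
    then show "\<exists>W\<in>N. W i j = \<alpha> \<and> (\<forall>r c. W r c \<noteq> 0 \<longrightarrow> r \<le> i \<and> j \<le> c)"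
      using full_corner_normal_closure[OF assms N ij(1,2)]
      unfolding full_corner_def cornered_def by blast
  qed
  then show ?thesis by (auto simp: normal_closure_def)
qed

section \<open>Blocks and the upper bound for the pseudocentre\<close>

text \<open>The matrix \<open>X\<close> pairs the indices of \<open>{a..b}\<close> other than \<open>u\<close> antitonically with indices outside:
  those below \<open>u\<close> are reflected to the left of \<open>a\<close>, those above \<open>u\<close> to the right of \<open>b\<close>. There is
  enough room outside for a suitable \<open>u\<close> exactly if \<open>2 * (b - a) < n\<close>.\<close>

lemma centralizer_trivial_block:
  fixes n a b :: nat
  assumes ab: "a < b" "b < n" "2 * b < n + 2 * a"
  obtains X :: "nat \<Rightarrow> nat \<Rightarrow> 'a::field" where "X \<in> strict_upper n"
    "\<And>Y r c. Y \<in> strict_upper n \<Longrightarrow> mat_mult n X Y = mat_mult n Y X \<Longrightarrow>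
      a \<le> r \<Longrightarrow> c \<le> b \<Longrightarrow> Y r c = 0"
proof -
  \<comment> \<open>Reflecting \<open>{a..<u}\<close> to the left of \<open>a\<close> needs
    \<open>u \<le> 2a\<close>; reflecting \<open>{u<..b}\<close> to the right of \<open>b\<close>
    needs \<open>2b - u < n\<close>. The minimum meets both conditions.\<close>
  define u where "u = min (2 * a) b"
  have u: "a \<le> u" "u \<le> b" "u \<le> 2 * a" "2 * b < n + u" using ab by (auto simp: u_def)
  define X :: "nat \<Rightarrow> nat \<Rightarrow> 'a" where
    "X r c = (if a \<le> c \<and> c < u \<and> r + c + 1 = 2 * a \<or> u < r \<and> r \<le> b \<and> r + c = 2 * b + 1
      then 1 else 0)" for r c
  have "X \<in> strict_upper n"
    by (rule strict_upperI) (use u in \<open>auto simp: X_def split: if_splits\<close>)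
  moreover have "Y r c = 0"
    if Y: "Y \<in> strict_upper n" and comm: "mat_mult n X Y = mat_mult n Y X"
      and rc: "a \<le> r" "c \<le> b" for Y r c
  proof (rule ccontr)
    assume nz: "Y r c \<noteq> 0"
    then have "r < c" "c < n" using strict_upperD'[OF Y] by auto
    then consider "u < c" | "r < u" by linarith
    then show False
    proof cases
      case 1
      \<comment> \<open>The partner of \<open>c\<close>. Column \<open>?d\<close> of
        \<open>X\<close> has its only entry in row \<open>c\<close>, so \<open>Y r c\<close> appears
        in \<open>YX\<close> at \<open>(r, ?d)\<close>. In \<open>XY\<close> only a partner of
        \<open>r\<close> beyond \<open>b\<close> could contribute; as the pairing is antitone it
        exceeds \<open>?d\<close>, where \<open>Y\<close> vanishes.\<close>
      let ?d = "2 * b + 1 - c"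
      have "mat_mult n Y X r ?d = (\<Sum>k<n. if k = c then Y r k else 0)"
        unfolding mat_mult_def using 1 u rc by (intro sum.cong) (auto simp: X_def)
      also have "\<dots> = Y r c" using \<open>c < n\<close> by simp
      finally have "mat_mult n X Y r ?d \<noteq> 0" using nz comm by simp
      then obtain k where "X r k \<noteq> 0" "Y k ?d \<noteq> 0" by (rule mat_mult_nonzeroE)
      then show False
        using strict_upperD'[OF Y, of k ?d] \<open>r < c\<close> rc u by (auto simp: X_def split: if_splits)
    next
      case 2
      \<comment> \<open>The mirror image of the first case: \<open>?d\<close> is the partner of
        \<open>r\<close> to the left of \<open>a\<close>, and \<open>Y r c\<close> appears in
        \<open>XY\<close> at \<open>(?d, c)\<close>.\<close>
      let ?d = "2 * a - 1 - r"
      have "mat_mult n X Y ?d c = (\<Sum>k<n. if k = r then Y k c else 0)"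
        unfolding mat_mult_def using 2 u rc by (intro sum.cong) (auto simp: X_def)
      also have "\<dots> = Y r c" using \<open>r < c\<close> \<open>c < n\<close> by simp
      finally have "mat_mult n Y X ?d c \<noteq> 0" using nz comm by simp
      then obtain k where "Y ?d k \<noteq> 0" "X k c \<noteq> 0" by (rule mat_mult_nonzeroE)
      then show False
        using strict_upperD'[OF Y, of ?d k] \<open>r < c\<close> rc u by (auto simp: X_def split: if_splits)
    qed
  qed
  ultimately show thesis using that by blast
qed

lemma pseudocentre_unitriangular:
  "pseudocentre (unitriangular n) = (strip n (n - n div 2) :: (nat \<Rightarrow> nat \<Rightarrow> 'a::field) set)"
proof
  show "strip n (n - n div 2) \<subseteq> pseudocentre (unitriangular n)"
    using strip_subset_normal_closure by (auto simp: pseudocentre_def)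
  show "pseudocentre (unitriangular n) \<subseteq> (strip n (n - n div 2) :: (nat \<Rightarrow> nat \<Rightarrow> 'a) set)"
  proof
    interpret group "unitriangular n :: (nat \<Rightarrow> nat \<Rightarrow> 'a) monoid" by (rule group_unitriangular)
    fix Z :: "nat \<Rightarrow> nat \<Rightarrow> 'a" assume Z: "Z \<in> pseudocentre (unitriangular n)"
    have Z_up: "Z \<in> strict_upper n" using Z pseudocentre_subset_carrier by auto
    have "a + (n - n div 2) \<le> b" if nz: "Z a b \<noteq> 0" for a b
    proof (rule ccontr)
      assume "\<not> ?thesis"
      moreover have ab: "a < b" "b < n" using strict_upperD'[OF Z_up nz] by auto
      ultimately have "2 * b < n + 2 * a" by linarith
      then obtain X :: "nat \<Rightarrow> nat \<Rightarrow> 'a" where X: "X \<in> strict_upper n"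
        "\<And>Y r c. Y \<in> strict_upper n \<Longrightarrow> mat_mult n X Y = mat_mult n Y X \<Longrightarrow>
          a \<le> r \<Longrightarrow> c \<le> b \<Longrightarrow> Y r c = 0"
        using centralizer_trivial_block[OF ab] by metis
      let ?K = "{X \<in> strict_upper n. \<forall>r c. a \<le> r \<and> c \<le> b \<longrightarrow> X r c = 0}"
      have "mat_mult n X Y = mat_mult n Y X" if "Y \<in> centralizer (unitriangular n) X" for Y
        using that by (simp add: centralizer_def add.commute)
      then have "centralizer (unitriangular n) X \<subseteq> ?K"
        using X(2) centralizer_subset_carrier[of "unitriangular n" X] by fastforce
      then have "normal_closure (unitriangular n) (centralizer (unitriangular n) X) \<subseteq> ?K"
        by (rule normal_closure_subset[OF block_kernel_normal])
      then have "Z \<in> ?K" using Z X(1) by (auto simp: pseudocentre_def)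
      then show False using nz by blast
    qed
    then show "Z \<in> strip n (n - n div 2)" using Z_up by (simp add: strip_def)
  qed
qed

section \<open>The McLain group as a unitriangular group\<close>

text \<open>For \<open>m = 0\<close> the elimination in \<open>subgroup_contains_strip\<close> can
  use the matrix units themselves as corners.\<close>

lemma generate_mat_units:
  "generate (unitriangular n) {mat_unit i j t | i j t. i < j \<and> j < n} = strict_upper n"
    (is "generate _ ?E = _")
proof
  interpret group "unitriangular n :: (nat \<Rightarrow> nat \<Rightarrow> 'a) monoid" by (rule group_unitriangular)
  have E: "?E \<subseteq> carrier (unitriangular n)" using mat_unit_strict_upper by auto
  then show "generate (unitriangular n) ?E \<subseteq> strict_upper n"
    using generate_incl unitriangular_simps(1) by blast
  have "strip n 0 \<subseteq> generate (unitriangular n) ?E"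
  proof (rule subgroup_contains_strip[OF generate_is_subgroup[OF E]])
    fix i j and \<alpha> :: 'a assume ij: "i < j" "j < n"
    have "mat_unit i j \<alpha> \<in> generate (unitriangular n) ?E"
      using ij by (intro generate.incl) auto
    then show "\<exists>W\<in>generate (unitriangular n) ?E.
        W i j = \<alpha> \<and> (\<forall>r c. W r c \<noteq> 0 \<longrightarrow> r \<le> i \<and> j \<le> c)"
      by (rule rev_bexI) (simp add: mat_unit_def)
  qed
  moreover have "strip n 0 = (strict_upper n :: (nat \<Rightarrow> nat \<Rightarrow> 'a) set)"
    by (auto simp: strip_def dest: strict_upperD')
  ultimately show "strict_upper n \<subseteq> generate (unitriangular n) ?E" by simp
qed

section \<open>Matrices acting on the basis\<close>

locale finite_ordered_basis = poset_basis scale v \<Lambda>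
  for scale :: "'f::field \<Rightarrow> 'v::ab_group_add \<Rightarrow> 'v" (infixr \<open>*s\<close> 75)
    and v :: "'l::linorder \<Rightarrow> 'v" and \<Lambda> :: "'l set" +
  assumes finite_index: "finite \<Lambda>"
begin

definition index :: "nat \<Rightarrow> 'l" where
  "index i = sorted_list_of_set \<Lambda> ! i"

lemma index_less: "i < j \<Longrightarrow> j < card \<Lambda> \<Longrightarrow> index i < index j"
  unfolding index_def using strict_sorted_list_of_set[of \<Lambda>]
  by (simp add: sorted_wrt_nth_less)

lemma index_image: "index ` {..<card \<Lambda>} = \<Lambda>"
  using finite_index set_sorted_list_of_set[of \<Lambda>]
  by (auto simp: index_def set_conv_nth)

lemma index_in: "i < card \<Lambda> \<Longrightarrow> index i \<in> \<Lambda>"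
  using index_image by blast

lemma index_inj: "inj_on index {..<card \<Lambda>}"
  by (rule linorder_inj_onI) (use index_less in fastforce)+

lemma index_eq_iff: "i < card \<Lambda> \<Longrightarrow> j < card \<Lambda> \<Longrightarrow> index i = index j \<longleftrightarrow> i = j"
  using index_inj by (simp add: inj_on_eq_iff)

text \<open>Row \<open>i\<close> of \<open>1 + X\<close> holds the coordinates of the image of the
  \<open>i\<close>-th basis vector, so composition from left to right matches the matrix product
  without a transpose.\<close>

definition endo :: "(nat \<Rightarrow> nat \<Rightarrow> 'f) \<Rightarrow> 'v \<Rightarrow> 'v" where
  "endo X = (\<lambda>x. x + (\<Sum>i<card \<Lambda>. \<Sum>j<card \<Lambda>. X i j *s e (index i) (index j) x))"

lemma linear_endo: "Vector_Spaces.linear scale scale (endo X)"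
  unfolding endo_def
  by (intro vs_pair.linear_compose_add vs_pair.linear_compose_sum vs_pair.linear_compose_scale_right
      linear_e ballI linear_ident)

lemma endo_basis:
  assumes "i < card \<Lambda>"
  shows "endo X (v (index i)) = v (index i) + (\<Sum>j<card \<Lambda>. X i j *s v (index j))"
proof -
  have "(\<Sum>j<card \<Lambda>. X k j *s e (index k) (index j) (v (index i))) =
      (if k = i then \<Sum>j<card \<Lambda>. X i j *s v (index j) else 0)" if "k < card \<Lambda>" for k
    using that assms by (auto simp: e_basis index_in index_eq_iff)
  then show ?thesis using assms by (simp add: endo_def)
qed

lemma endo_mult: "endo (X + Y + mat_mult (card \<Lambda>) X Y) = endo Y \<circ> endo X"
proof (rule linear_eq_basis)
  show "Vector_Spaces.linear scale scale (endo Y \<circ> endo X)"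
    by (rule Vector_Spaces.linear_compose[OF linear_endo linear_endo])
  fix z assume "z \<in> \<Lambda>"
  then obtain i where i: "i < card \<Lambda>" "z = index i" using index_image by blast
  let ?n = "card \<Lambda>"
  have "endo Y (endo X (v z)) = endo Y (v z) + (\<Sum>k<?n. X i k *s endo Y (v (index k)))"
    unfolding i(2) endo_basis[OF i(1), of X]
    by (simp add: vs_pair.linear_add[OF linear_endo] vs_pair.linear_sum[OF linear_endo]
        vs_pair.linear_scale[OF linear_endo])
  also have "(\<Sum>k<?n. X i k *s endo Y (v (index k))) =
      (\<Sum>k<?n. X i k *s v (index k)) + (\<Sum>k<?n. \<Sum>j<?n. (X i k * Y k j) *s v (index j))"
    by (simp add: endo_basis scale_right_distrib scale_sum_right sum.distrib)
  also have "(\<Sum>k<?n. \<Sum>j<?n. (X i k * Y k j) *s v (index j)) =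
      (\<Sum>j<?n. mat_mult ?n X Y i j *s v (index j))"
    by (subst sum.swap) (simp add: mat_mult_def scale_sum_left)
  finally show "endo (X + Y + mat_mult ?n X Y) (v z) = (endo Y \<circ> endo X) (v z)"
    using i by (simp add: endo_basis scale_left_distrib sum.distrib algebra_simps)
qed (rule linear_endo)

lemma endo_zero: "endo 0 = id"
  by (simp add: endo_def fun_eq_iff)

lemma endo_in_GL:
  assumes "X \<in> strict_upper (card \<Lambda>)"
  shows "endo X \<in> carrier GL"
proof -
  interpret group "unitriangular (card \<Lambda>) :: (nat \<Rightarrow> nat \<Rightarrow> 'f) monoid"
    by (rule group_unitriangular)
  let ?U = "unitriangular (card \<Lambda>) :: (nat \<Rightarrow> nat \<Rightarrow> 'f) monoid"
  let ?Y = "inv\<^bsub>?U\<^esub> X"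
  have "X \<otimes>\<^bsub>?U\<^esub> ?Y = 0" "?Y \<otimes>\<^bsub>?U\<^esub> X = 0"
    using assms r_inv[of X] l_inv[of X] by (simp_all del: unitriangular_simps(2))
  then have "endo X \<circ> endo ?Y = id" "endo ?Y \<circ> endo X = id"
    by (simp_all add: endo_mult[symmetric] endo_zero)
  then have "bij (endo X)" by (metis o_bij)
  then show ?thesis using linear_endo by (simp add: GL_def)
qed

lemma group_hom_endo: "group_hom (unitriangular (card \<Lambda>)) GL endo"
  unfolding group_hom_def group_hom_axioms_def
proof (intro conjI group_unitriangular group_GL homI)
  fix X Y :: "nat \<Rightarrow> nat \<Rightarrow> 'f"
  assume X: "X \<in> carrier (unitriangular (card \<Lambda>))"
  then show "endo X \<in> carrier GL" by (simp add: endo_in_GL)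
  show "endo (X \<otimes>\<^bsub>unitriangular (card \<Lambda>)\<^esub> Y) = endo X \<otimes>\<^bsub>GL\<^esub> endo Y"
    by (simp add: GL_def endo_mult)
qed

text \<open>The rows are recovered as coordinates with respect to the basis; entries outside the
  index range are zero in both matrices.\<close>

lemma inj_on_endo: "inj_on endo (strict_upper (card \<Lambda>))"
proof
  fix X Y assume XY: "X \<in> strict_upper (card \<Lambda>)" "Y \<in> strict_upper (card \<Lambda>)" "endo X = endo Y"
  let ?n = "card \<Lambda>"
  have inj: "inj_on (v \<circ> index) {..<?n}"
    using comp_inj_on[OF index_inj] inj_basis index_image by simp
  have image: "(v \<circ> index) ` {..<?n} = v ` \<Lambda>" using index_image by (metis image_comp)
  show "X = Y"
  proof (intro ext)
    fix i j
    show "X i j = Y i j"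
    proof (cases "i < ?n \<and> j < ?n")
      case True
      \<comment> \<open>Linear independence speaks of coefficients indexed by vectors, so the column
        index is recovered from the basis vector.\<close>
      define c where "c b = (X - Y) i (inv_into {..<?n} (v \<circ> index) b)" for b
      have "(\<Sum>k<?n. X i k *s v (index k)) = (\<Sum>k<?n. Y i k *s v (index k))"
        using True arg_cong[OF XY(3), of "\<lambda>f. f (v (index i))"] by (simp add: endo_basis)
      then have "0 = (\<Sum>k<?n. (X - Y) i k *s v (index k))"
        by (simp add: scale_left_diff_distrib sum_subtractf)
      also have "\<dots> = (\<Sum>k<?n. c ((v \<circ> index) k) *s (v \<circ> index) k)"
        using inj by (intro sum.cong refl) (simp add: c_def inv_into_f_f del: comp_apply, simp)
      also have "\<dots> = (\<Sum>b\<in>v ` \<Lambda>. c b *s b)"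
        unfolding image[symmetric] by (subst sum.reindex[OF inj]) simp
      finally have "c ((v \<circ> index) j) = 0"
        using independentD[OF independent_basis, of "v ` \<Lambda>" c] finite_index True index_in by auto
      then show ?thesis using inj True by (simp add: c_def inv_into_f_f del: comp_apply)
    next
      case False
      then show ?thesis using XY(1,2) strict_upperD[of _ ?n i j] by (metis less_trans)
    qed
  qed
qed

lemma endo_mat_unit:
  assumes "i < j" "j < card \<Lambda>"
  shows "endo (mat_unit i j t) = transvection t (index i) (index j)"
proof (rule linear_eq_basis)
  have "transvection t (index i) (index j) \<in> carrier GL"
    using assms by (intro transvection_in_GL index_in index_less) auto
  then show "Vector_Spaces.linear scale scale (transvection t (index i) (index j))"
    by (simp add: GL_def)
  fix z assume "z \<in> \<Lambda>"
  then obtain k where k: "k < card \<Lambda>" "z = index k" using index_image by blast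
  have "(\<Sum>l<card \<Lambda>. mat_unit i j t k l *s v (index l)) =
      (\<Sum>l<card \<Lambda>. if l = j then (if k = i then t *s v (index j) else 0) else 0)"
    by (intro sum.cong) (auto simp: mat_unit_def)
  then show "endo (mat_unit i j t) (v z) = transvection t (index i) (index j) (v z)"
    using k assms by (auto simp: endo_basis transvection_def e_basis index_in index_eq_iff)
qed (rule linear_endo)

text \<open>Matrix units correspond to transvections, and a homomorphism maps a generated subgroup
  onto the subgroup generated by the images. As the matrix units generate all unitriangular
  matrices, the image is the McLain group.\<close>

lemma endo_iso: "endo \<in> iso (unitriangular (card \<Lambda>)) mclain_group"
proof -
  interpret group_hom "unitriangular (card \<Lambda>)" GL endo by (rule group_hom_endo)
  let ?E = "{mat_unit i j t | i j t. i < j \<and> j < card \<Lambda>}"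
  let ?T = "{transvection a l m | a l m. l \<in> \<Lambda> \<and> m \<in> \<Lambda> \<and> l < m}"
  have "endo ` ?E = ?T"
  proof
    show "endo ` ?E \<subseteq> ?T"
      using endo_mat_unit index_in index_less less_trans by blast
    show "?T \<subseteq> endo ` ?E"
    proof
      fix f assume "f \<in> ?T"
      then obtain a l m where f: "f = transvection a l m" "l \<in> \<Lambda>" "m \<in> \<Lambda>" "l < m" by blast
      then obtain i j where ij: "i < card \<Lambda>" "j < card \<Lambda>" "l = index i" "m = index j"
        using index_image by blast
      then have "i < j" using f(4) index_less[of j i] by (metis linorder_neqE_nat order.asym less_irrefl)
      then have "f = endo (mat_unit i j a)" "mat_unit i j a \<in> ?E"
        using f(1) ij endo_mat_unit[of i j a] by auto
      then show "f \<in> endo ` ?E" by (rule image_eqI)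
    qed
  qed
  moreover have "endo ` generate (unitriangular (card \<Lambda>)) ?E = generate GL (endo ` ?E)"
    using mat_unit_strict_upper by (intro generate_img[symmetric]) auto
  ultimately have "endo ` strict_upper (card \<Lambda>) = generate GL ?T"
    unfolding generate_mat_units by simp
  then have "endo ` strict_upper (card \<Lambda>) = carrier mclain_group"
    by (simp add: mclain_group_def)
  moreover from this have "endo \<in> hom (unitriangular (card \<Lambda>)) mclain_group"
    using homh by (auto simp: hom_def mclain_group_def)
  ultimately show ?thesis
    using inj_on_endo by (simp add: iso_def bij_betw_def)
qed

end

theorem theorem4p2:
  fixes scale :: "'f::field \<Rightarrow> 'v::ab_group_add \<Rightarrow> 'v"
    and v :: "'l::linorder \<Rightarrow> 'v"
    and \<Lambda> :: "'l set"
    and n :: nat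
  assumes "poset_basis scale v \<Lambda>"
    and "finite \<Lambda>"
    and "card \<Lambda> = n"
  shows "pseudocentre (poset_basis.mclain_group scale v \<Lambda>) =
         upper_central (poset_basis.mclain_group scale v \<Lambda>) (n div 2)"
proof -
  interpret finite_ordered_basis scale v \<Lambda>
    using assms by (simp add: finite_ordered_basis_def finite_ordered_basis_axioms_def)
  let ?U = "unitriangular n :: (nat \<Rightarrow> nat \<Rightarrow> 'f) monoid"
  have iso: "endo \<in> iso ?U mclain_group" using endo_iso assms(3) by simp
  have "pseudocentre mclain_group = endo ` pseudocentre ?U"
    by (rule pseudocentre_iso[OF iso group_unitriangular group_mclain_group])
  also have "pseudocentre ?U = upper_central ?U (n div 2)"
    by (simp add: pseudocentre_unitriangular upper_central_unitriangular)
  also have "endo ` upper_central ?U (n div 2) = upper_central mclain_group (n div 2)"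
    by (rule upper_central_iso[OF iso group_unitriangular group_mclain_group, symmetric])
  finally show ?thesis .
qed

end
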